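(* Assume the nonlinear map $\alpha:\hat H\to\mathbb{R}^m$, $(\alpha(x))_k=|\langle x,f_k\rangle|^2$, is injective. Then the map $\mathcal{A}:\mathcal{S}^{1,0}\rightarrow\mathbb{R}^m$, $\mathcal{A}(xx^* )=\alpha(x)$, is bi-Lipschitz between $(\mathcal{S}^{1,0},\|\cdot\|_1)$ and $(\mathbb{R}^m,\|\cdot\|)$ with the Euclidean norm, and it has the upper Lipschitz bound $$B_0 = \sqrt{\max_{\xi\in H_{\mathbb{R}}, \|\xi\|=1} \|R(\xi)\| }$$ and the lower Lipschitz bound $$A_0 = \sqrt{\min_{\xi\in H_{\mathbb{R}},\|\xi\|=1} a_{2n-1}(R(\xi))}.$$ Specifically $$A_0 \|xx^*-yy^*\|_1 \leq \|\mathcal{A}(xx^* ) - \mathcal{A}(yy^* )\| \leq B_0 \|xx^*-yy^*\|_1$$ for all $x,y\in H$.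
   Context: $H$ is a complex Hilbert space of finite dimension $n$, with scalar product $\langle\cdot,\cdot\rangle$ linear in the first and antilinear in the second argument, and with a conjugation $c:H\to H$ (antilinear, $c\circ c=\mathrm{id}$, $\langle c(x),c(y)\rangle=\langle y,x\rangle$). $\{f_1,\dots,f_m\}$ is a frame (spanning set) for $H$. $\hat H=H/\sim$, where $x\sim y$ iff $y=zx$ for some $z\in\mathbb{C}$ with $|z|=1$. For $x\in H$, $xx^*$ is the operator $v\mapsto\langle v,x\rangle x$; $\mathcal{S}^{1,0}=\{xx^*: x\in H\}$ is the set of positive semidefinite self-adjoint operators on $H$ of rank at most 1. $\|\cdot\|_1$ on operators is the nuclear norm (sum of singular values). Realification: $\mathbf{j}:H\to H\times H$, $\mathbf{j}(v)=\left(\frac12(v+c(v)),\frac1{2i}(v-c(v))\right)$; $H_{\mathbb{R}}=\mathbf{j}(H)$, a real vector space of dimension $2n$ with the real inner product $\langle \mathbf{j}(v),\mathbf{j}(w)\rangle=\mathrm{real}\langle v,w\rangle$. $J:H_{\mathbb{R}}\to H_{\mathbb{R}}$ is $J(v,w)=(-w,v)$, so $J\mathbf{j}(v)=\mathbf{j}(iv)$. Adjoints in $H_{\mathbb{R}}$ are with respect to this real inner product, and for $\xi\in H_{\mathbb{R}}$, $\xi\xi^*$ is the operator $\eta\mapsto\langle\eta,\xi\rangle\xi$. Put $\varphi_k=\mathbf{j}(f_k)$, $\Phi_k=\varphi_k\varphi_k^*+J\varphi_k\varphi_k^*J^*$, and for $\xi\in H_{\mathbb{R}}$, $R(\xi)=\sum_{k=1}^m\Phi_k\xi\xi^*\Phi_k$,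 a symmetric positive semidefinite operator on $H_{\mathbb{R}}$. $\|R(\xi)\|$ is its operator norm and $a_{2n-1}(R(\xi))$ is its next to the smallest eigenvalue (the $(2n-1)$-th of its $2n$ eigenvalues, counted with multiplicity in decreasing order). *)

theory Defs
  imports "HOL-Analysis.Analysis"
begin

section \<open>Finite-dimensional complex Hilbert spaces\<close>

text \<open>
  The types of this class are the nonzero finite-dimensional complex Hilbert spaces. The complex
  scalar product is linear in the first and antilinear in the second argument; the inherited real
  inner product is its real part, so that \<open>norm x\<close> is the Hilbert space norm and
  \<open>DIM('a)\<close> is the real dimension, i.e. twice the complex dimension. Positive definiteness
  of \<open>cinner\<close> is inherited from \<open>inner\<close>. The distinguished real
  orthonormal basis \<open>Basis\<close> only expresses finite dimensionality and plays no other role.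
\<close>

class complex_euclidean_space = euclidean_space +
  fixes scaleC :: "complex \<Rightarrow> 'a \<Rightarrow> 'a" (infixr "*\<^sub>C" 75)
    and cinner :: "'a \<Rightarrow> 'a \<Rightarrow> complex"
  assumes scaleC_add_right: "a *\<^sub>C (x + y) = a *\<^sub>C x + a *\<^sub>C y"
    and scaleC_add_left: "(a + b) *\<^sub>C x = a *\<^sub>C x + b *\<^sub>C x"
    and scaleC_scaleC: "a *\<^sub>C b *\<^sub>C x = (a * b) *\<^sub>C x"
    and scaleC_of_real: "complex_of_real r *\<^sub>C x = r *\<^sub>R x"
    and cinner_add_left: "cinner (x + y) z = cinner x z + cinner y z"
    and cinner_scaleC_left: "cinner (a *\<^sub>C x) y = a * cinner x y"
    and cinner_commute: "cinner y x = cnj (cinner x y)"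
    and Re_cinner: "Re (cinner x y) = inner x y"

instantiation complex :: complex_euclidean_space
begin
definition scaleC_complex :: "complex \<Rightarrow> complex \<Rightarrow> complex" where "scaleC_complex = (*)"
definition cinner_complex :: "complex \<Rightarrow> complex \<Rightarrow> complex" where "cinner_complex x y = x * cnj y"
instance
  by standard
    (auto simp: scaleC_complex_def cinner_complex_def algebra_simps scaleR_conv_of_real
      inner_complex_def)
end

instantiation vec :: (complex_euclidean_space, finite) complex_euclidean_space
begin
definition scaleC_vec :: "complex \<Rightarrow> 'a ^ 'b \<Rightarrow> 'a ^ 'b" where
  "scaleC_vec a x = (\<chi> i. a *\<^sub>C (x $ i))"
definition cinner_vec :: "'a ^ 'b \<Rightarrow> 'a ^ 'b \<Rightarrow> complex" where
  "cinner_vec x y = (\<Sum>i\<in>UNIV. cinner (x $ i) (y $ i))"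
instance
proof
  fix x y :: "'a ^ 'b"
  show "cinner y x = cnj (cinner x y)"
    unfolding cinner_vec_def cnj_sum by (intro sum.cong refl cinner_commute)
qed (auto simp: scaleC_vec_def cinner_vec_def vec_eq_iff scaleC_add_right scaleC_add_left
      scaleC_scaleC scaleC_of_real cinner_add_left cinner_scaleC_left Re_cinner inner_vec_def
      sum.distrib sum_distrib_left)
end

lemma scaleC_one [simp]: "1 *\<^sub>C (x :: 'a::complex_euclidean_space) = x"
  using scaleC_of_real [of 1 x] by simp

global_interpretation complex_vs: vector_space
  "scaleC :: complex \<Rightarrow> 'a \<Rightarrow> 'a::complex_euclidean_space"
  defines cspan = complex_vs.span and cdim = complex_vs.dim
  by unfold_locales (simp_all add: scaleC_add_right scaleC_add_left scaleC_scaleC)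

lemma cinner_add_right: "cinner x (y + z) = cinner x y + cinner x z"
  by (metis cinner_add_left cinner_commute complex_cnj_add)

lemma cinner_scaleC_right: "cinner x (a *\<^sub>C y) = cnj a * cinner x y"
  by (metis cinner_scaleC_left cinner_commute complex_cnj_mult)

definition conjugation :: "('a::complex_euclidean_space \<Rightarrow> 'a) \<Rightarrow> bool" where
  "conjugation c \<longleftrightarrow>
     (\<forall>x y. c (x + y) = c x + c y) \<and> (\<forall>a x. c (a *\<^sub>C x) = cnj a *\<^sub>C c x) \<and>
     (\<forall>x. c (c x) = x) \<and> (\<forall>x y. cinner (c x) (c y) = cinner y x)"

definition is_frame :: "('m::finite \<Rightarrow> 'a::complex_euclidean_space) \<Rightarrow> bool" where
  "is_frame f \<longleftrightarrow> cspan (range f) = UNIV"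


section \<open>Nuclear norm\<close>

definition cadjoint ::
  "('a::complex_euclidean_space \<Rightarrow> 'a) \<Rightarrow> 'a \<Rightarrow> 'a" where
  "cadjoint T = (SOME T'. \<forall>x y. cinner (T x) y = cinner x (T' y))"

text \<open>
  The singular values are the square roots of the eigenvalues of \<open>T\<^sup>* T\<close>; in the nuclear norm
  each one is counted with the (complex) dimension of the corresponding eigenspace.
\<close>

definition singular_space ::
  "('a::complex_euclidean_space \<Rightarrow> 'a) \<Rightarrow> real \<Rightarrow> 'a set" where
  "singular_space T s = {v. cadjoint T (T v) = complex_of_real (s\<^sup>2) *\<^sub>C v}"

definition singular_values :: "('a::complex_euclidean_space \<Rightarrow> 'a) \<Rightarrow> real set" where
  "singular_values T = {s. s \<ge> 0 \<and> (\<exists>v\<noteq>0. v \<in> singular_space T s)}"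

definition nuclear_norm :: "('a::complex_euclidean_space \<Rightarrow> 'a) \<Rightarrow> real" where
  "nuclear_norm T = (\<Sum>s\<in>singular_values T. real (cdim (singular_space T s)) * s)"

definition nuclear_dist ::
  "('a::complex_euclidean_space \<Rightarrow> 'a) \<Rightarrow> ('a \<Rightarrow> 'a) \<Rightarrow> real" where
  "nuclear_dist S T = nuclear_norm (\<lambda>v. S v - T v)"


section \<open>The maps \<open>\<alpha>\<close> and \<open>\<A>\<close>\<close>

definition phase_rel :: "('a::complex_euclidean_space \<times> 'a) set" where
  "phase_rel = {(x, y). \<exists>z. cmod z = 1 \<and> y = z *\<^sub>C x}"

abbreviation phase_class :: "'a::complex_euclidean_space \<Rightarrow> 'a set" where
  "phase_class x \<equiv> phase_rel `` {x}"

definition H_hat :: "'a::complex_euclidean_space set set" where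
  "H_hat = UNIV // phase_rel"

definition intensity ::
  "('m::finite \<Rightarrow> 'a::complex_euclidean_space) \<Rightarrow> 'a \<Rightarrow> real ^ 'm" where
  "intensity f x = (\<chi> k. (cmod (cinner x (f k)))\<^sup>2)"

definition alpha ::
  "('m::finite \<Rightarrow> 'a::complex_euclidean_space) \<Rightarrow> 'a set \<Rightarrow> real ^ 'm" where
  "alpha f X = the_elem (intensity f ` X)"

definition rank_one :: "'a::complex_euclidean_space \<Rightarrow> 'a \<Rightarrow> 'a" where
  "rank_one x = (\<lambda>v. cinner v x *\<^sub>C x)"

definition S10 :: "('a::complex_euclidean_space \<Rightarrow> 'a) set" where
  "S10 = range rank_one"

definition lifted_map ::
  "('m::finite \<Rightarrow> 'a::complex_euclidean_space) \<Rightarrow> ('a \<Rightarrow> 'a) \<Rightarrow> real ^ 'm" where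
  "lifted_map f T = the_elem ((\<lambda>x. alpha f (phase_class x)) ` {x. rank_one x = T})"

lemma equiv_phase_rel: "equiv UNIV (phase_rel :: ('a::complex_euclidean_space \<times> 'a) set)"
proof (rule equivI)
  show "refl (phase_rel :: ('a \<times> 'a) set)"
    by (auto simp: refl_on_def phase_rel_def intro!: exI [of _ 1])
  show "sym (phase_rel :: ('a \<times> 'a) set)"
  proof (rule symI)
    fix x y :: 'a assume "(x, y) \<in> phase_rel"
    then obtain z where z: "cmod z = 1" "y = z *\<^sub>C x" by (auto simp: phase_rel_def)
    then have "cnj z * z = 1"
      by (metis complex_norm_square mult.commute of_real_1 power_one)
    then have "x = cnj z *\<^sub>C y" by (simp add: z scaleC_scaleC)
    then show "(y, x) \<in> phase_rel" using z by (auto simp: phase_rel_def intro!: exI [of _ "cnj z"])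
  qed
  show "trans (phase_rel :: ('a \<times> 'a) set)"
  proof (rule transI)
    fix x y w :: 'a assume "(x, y) \<in> phase_rel" "(y, w) \<in> phase_rel"
    then obtain a b where "cmod a = 1" "y = a *\<^sub>C x" "cmod b = 1" "w = b *\<^sub>C y"
      by (auto simp: phase_rel_def)
    then show "(x, w) \<in> phase_rel"
      by (auto simp: phase_rel_def scaleC_scaleC norm_mult intro!: exI [of _ "b * a"])
  qed
qed auto

lemma alpha_phase_class: "alpha f (phase_class x) = intensity f x"
proof -
  have "intensity f ` phase_class x = {intensity f x}"
  proof
    show "intensity f ` phase_class x \<subseteq> {intensity f x}"
      by (auto simp: phase_rel_def intensity_def cinner_scaleC_left norm_mult vec_eq_iff)
    show "{intensity f x} \<subseteq> intensity f ` phase_class x"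
      by (auto simp: phase_rel_def intro!: image_eqI [of _ _ x] exI [of _ 1])
  qed
  then show ?thesis by (simp add: alpha_def)
qed

lemma lifted_map_rank_one: "lifted_map f (rank_one x) = alpha f (phase_class x)"
proof -
  have *: "complex_of_real (intensity f y $ k) = cinner (rank_one y (f k)) (f k)" for y k
  proof -
    have "complex_of_real (intensity f y $ k) = cinner y (f k) * cnj (cinner y (f k))"
      unfolding intensity_def vec_lambda_beta by (rule complex_norm_square)
    then show ?thesis
      by (simp only: rank_one_def cinner_scaleC_left cinner_commute [of "f k" y] mult.commute)
  qed
  have **: "intensity f y = intensity f x" if "rank_one y = rank_one x" for y
    using *[of y] *[of x] that by (metis of_real_eq_iff vec_eq_iff)
  have "(\<lambda>y. alpha f (phase_class y)) ` {y. rank_one y = rank_one x} = {intensity f x}"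
    unfolding alpha_phase_class by (blast dest: **)
  then show ?thesis by (simp add: lifted_map_def alpha_phase_class)
qed

definition bi_lipschitz_on ::
  "'s set \<Rightarrow> ('s \<Rightarrow> 's \<Rightarrow> real) \<Rightarrow> ('s \<Rightarrow> 'b::metric_space) \<Rightarrow> bool" where
  "bi_lipschitz_on D d F \<longleftrightarrow>
     (\<exists>a>0. \<exists>b>0. \<forall>S\<in>D. \<forall>T\<in>D. a * d S T \<le> dist (F S) (F T) \<and> dist (F S) (F T) \<le> b * d S T)"


section \<open>Realification\<close>

definition realify ::
  "('a::complex_euclidean_space \<Rightarrow> 'a) \<Rightarrow> 'a \<Rightarrow> 'a \<times> 'a" where
  "realify c v = ((1 / 2) *\<^sub>C (v + c v), (1 / (2 * \<i>)) *\<^sub>C (v - c v))"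

definition H_R :: "('a::complex_euclidean_space \<Rightarrow> 'a) \<Rightarrow> ('a \<times> 'a) set" where
  "H_R c = range (realify c)"

definition J :: "'a::complex_euclidean_space \<times> 'a \<Rightarrow> 'a \<times> 'a" where
  "J \<xi> = (- snd \<xi>, fst \<xi>)"

definition real_rank_one :: "'b::real_inner \<Rightarrow> 'b \<Rightarrow> 'b" where
  "real_rank_one \<xi> = (\<lambda>\<eta>. inner \<eta> \<xi> *\<^sub>R \<xi>)"

text \<open>
  Operators on \<open>H_R c\<close> are represented by functions on the ambient product space that map
  \<open>H_R c\<close> into itself. The lemmas below show that the inner product of the product space
  restricts to \<open>Re \<langle>v, w\<rangle>\<close>, and that both \<open>J\<close> and its ambient adjoint
  preserve \<open>H_R c\<close>, so that the latter restricts to the adjoint of \<open>J\<close> on \<open>H_R c\<close>.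
\<close>

definition Phi ::
  "('a::complex_euclidean_space \<Rightarrow> 'a) \<Rightarrow> ('m::finite \<Rightarrow> 'a) \<Rightarrow> 'm \<Rightarrow> 'a \<times> 'a \<Rightarrow> 'a \<times> 'a" where
  "Phi c f k = (\<lambda>\<eta>. real_rank_one (realify c (f k)) \<eta>
                 + J (real_rank_one (realify c (f k)) (adjoint J \<eta>)))"

definition R_op ::
  "('a::complex_euclidean_space \<Rightarrow> 'a) \<Rightarrow> ('m::finite \<Rightarrow> 'a) \<Rightarrow> 'a \<times> 'a \<Rightarrow> 'a \<times> 'a \<Rightarrow> 'a \<times> 'a" where
  "R_op c f \<xi> = (\<lambda>\<eta>. \<Sum>k\<in>UNIV. Phi c f k (real_rank_one \<xi> (Phi c f k \<eta>)))"

lemma inner_realify: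
  assumes "conjugation c"
  shows "inner (realify c v) (realify c w) = Re (cinner v w)"
proof -
  have scale: "inner (z *\<^sub>C x) (z *\<^sub>C y) = (cmod z)\<^sup>2 * inner x y" for z and x y :: 'a
  proof -
    have "cinner (z *\<^sub>C x) (z *\<^sub>C y) = complex_of_real ((cmod z)\<^sup>2) * cinner x y"
      by (simp only: cinner_scaleC_left cinner_scaleC_right complex_norm_square mult_ac)
    then have "Re (cinner (z *\<^sub>C x) (z *\<^sub>C y)) = (cmod z)\<^sup>2 * Re (cinner x y)"
      by simp
    then show ?thesis by (simp only: Re_cinner)
  qed
  have "cinner (c v) (c w) = cinner w v"
    using assms by (simp only: conjugation_def)
  then have "inner (c v) (c w) = inner v w"
    using Re_cinner [of "c v" "c w"] Re_cinner [of w v] by (simp only: inner_commute)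
  then have "inner (v + c v) (w + c w) + inner (v - c v) (w - c w) = 4 * inner v w"
    by (simp add: inner_add_left inner_add_right inner_diff_left inner_diff_right)
  moreover have "(cmod (1 / 2))\<^sup>2 = 1 / 4" "(cmod (1 / (2 * \<i>)))\<^sup>2 = 1 / 4"
    by (simp_all add: norm_divide norm_mult power2_eq_square)
  ultimately show ?thesis
    by (simp only: realify_def inner_prod_def fst_conv snd_conv scale Re_cinner)
qed

lemma J_realify:
  assumes "conjugation c"
  shows "J (realify c v) = realify c (\<i> *\<^sub>C v)"
proof -
  have ci: "c (\<i> *\<^sub>C v) = - (\<i> *\<^sub>C c v)"
    using assms by (simp add: conjugation_def)
  have i: "1 / (2 * \<i>) = - (\<i> / 2)"
    by (simp add: complex_eq_iff)
  show ?thesis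
    unfolding J_def realify_def ci i
    by (simp add: scaleC_add_right complex_vs.scale_right_diff_distrib scaleC_scaleC)
qed

lemma adjoint_J: "adjoint J \<xi> = - J (\<xi> :: 'a::complex_euclidean_space \<times> 'a)"
proof -
  have "adjoint J = (\<lambda>\<xi> :: 'a \<times> 'a. - J \<xi>)"
    by (rule adjoint_unique) (auto simp: J_def inner_prod_def)
  then show ?thesis by simp
qed

lemma J_H_R: "conjugation c \<Longrightarrow> J ` H_R c \<subseteq> H_R c"
  by (auto simp: H_R_def J_realify)

lemma adjoint_J_H_R:
  assumes "conjugation c"
  shows "adjoint J ` H_R c \<subseteq> H_R c"
proof -
  have "c (- v) = - c v" for v
    using assms complex_vs.scale_minus_left [of 1 v] complex_vs.scale_minus_left [of 1 "c v"]
    unfolding conjugation_def by (metis complex_cnj_minus complex_cnj_one scaleC_one)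
  then have "- realify c v = realify c (- v)" for v
    by (simp add: realify_def flip: complex_vs.scale_minus_right)
  then show ?thesis
    by (force simp: adjoint_J H_R_def J_realify [OF assms])
qed


section \<open>Operator norm and ordered eigenvalues on a real subspace\<close>

definition onorm_on :: "'b::real_normed_vector set \<Rightarrow> ('b \<Rightarrow> 'b) \<Rightarrow> real" where
  "onorm_on V T = (SUP x\<in>V. norm (T x) / norm x)"

definition eigenspace_on :: "'b::real_vector set \<Rightarrow> ('b \<Rightarrow> 'b) \<Rightarrow> real \<Rightarrow> 'b set" where
  "eigenspace_on V T l = {x \<in> V. T x = l *\<^sub>R x}"

definition eigenvalues_on :: "'b::real_vector set \<Rightarrow> ('b \<Rightarrow> 'b) \<Rightarrow> real set" where
  "eigenvalues_on V T = {l. \<exists>x\<noteq>0. x \<in> eigenspace_on V T l}"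

text \<open>
  Multiplicities are geometric. This is the usual notion for the symmetric operators considered
  here, for which \<open>eigenvalue_list\<close> has \<open>dim V\<close> entries. The numbering in
  \<open>nth_eigenvalue\<close> starts from 1, the largest eigenvalue.
\<close>

definition eigenvalue_mset :: "'b::real_vector set \<Rightarrow> ('b \<Rightarrow> 'b) \<Rightarrow> real multiset" where
  "eigenvalue_mset V T =
     (\<Sum>l\<in>eigenvalues_on V T. replicate_mset (dim (eigenspace_on V T l)) l)"

definition eigenvalue_list :: "'b::real_vector set \<Rightarrow> ('b \<Rightarrow> 'b) \<Rightarrow> real list" where
  "eigenvalue_list V T = rev (sorted_list_of_multiset (eigenvalue_mset V T))"

definition nth_eigenvalue :: "'b::real_vector set \<Rightarrow> ('b \<Rightarrow> 'b) \<Rightarrow> nat \<Rightarrow> real" where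
  "nth_eigenvalue V T k = eigenvalue_list V T ! (k - 1)"


section \<open>The Lipschitz bounds\<close>

definition unit_sphere_R :: "('a::complex_euclidean_space \<Rightarrow> 'a) \<Rightarrow> ('a \<times> 'a) set" where
  "unit_sphere_R c = {\<xi> \<in> H_R c. norm \<xi> = 1}"

definition norm_R ::
  "('a::complex_euclidean_space \<Rightarrow> 'a) \<Rightarrow> ('m::finite \<Rightarrow> 'a) \<Rightarrow> 'a \<times> 'a \<Rightarrow> real" where
  "norm_R c f \<xi> = onorm_on (H_R c) (R_op c f \<xi>)"

definition next_smallest_eigenvalue_R ::
  "('a::complex_euclidean_space \<Rightarrow> 'a) \<Rightarrow> ('m::finite \<Rightarrow> 'a) \<Rightarrow> 'a \<times> 'a \<Rightarrow> real" where
  "next_smallest_eigenvalue_R c f \<xi> =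
     nth_eigenvalue (H_R c) (R_op c f \<xi>) (2 * cdim (UNIV :: 'a set) - 1)"

text \<open>
  Suprema and infima are used as total functions; that they are attained, i.e. are the
  maximum and minimum, has to be stated separately.
\<close>

definition B0 :: "('a::complex_euclidean_space \<Rightarrow> 'a) \<Rightarrow> ('m::finite \<Rightarrow> 'a) \<Rightarrow> real" where
  "B0 c f = sqrt (SUP \<xi>\<in>unit_sphere_R c. norm_R c f \<xi>)"

definition A0 :: "('a::complex_euclidean_space \<Rightarrow> 'a) \<Rightarrow> ('m::finite \<Rightarrow> 'a) \<Rightarrow> real" where
  "A0 c f = sqrt (INF \<xi>\<in>unit_sphere_R c. next_smallest_eigenvalue_R c f \<xi>)"

end

theory Submission
  imports Defs
begin

text \<open>
  Write \<open>u = x + y\<close> and \<open>v = x - y\<close>. Each \<open>k\<close> contributes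
  \<open>\<bar>\<langle>x, f\<^sub>k\<rangle>\<bar>\<^sup>2 - \<bar>\<langle>y, f\<^sub>k\<rangle>\<bar>\<^sup>2 = Re (\<langle>u, f\<^sub>k\<rangle> cnj \<langle>v, f\<^sub>k\<rangle>)\<close>, so the difference of the intensities is
  the value \<open>\<beta>(u, v)\<close> of a real-bilinear map \<open>\<beta>\<close>, called \<open>polarized_intensity\<close> below. In the
  realification \<open>\<Phi>\<^sub>k\<close> is \<open>f\<^sub>k f\<^sub>k\<^sup>*\<close>, and for \<open>\<xi> = realify c u\<close> the quadratic form of \<open>R(\<xi>)\<close> at
  \<open>realify c w\<close> is \<open>\<parallel>\<beta>(u, w)\<parallel>\<^sup>2\<close> (\<open>inner_R_op\<close>). Moreover \<open>\<beta>(u, \<i> u) = 0\<close>, so \<open>J \<xi>\<close> is a null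
  vector of \<open>R(\<xi>)\<close>, and \<open>v\<close> may be replaced by its component \<open>w\<close> orthogonal to \<open>\<i> u\<close> without
  changing \<open>\<beta>(u, v)\<close>.

  The nuclear norm of \<open>x x\<^sup>* - y y\<^sup>*\<close> involves the same component. Its square is
  \<open>(\<parallel>x\<parallel>\<^sup>2 + \<parallel>y\<parallel>\<^sup>2)\<^sup>2 - 4 \<bar>\<langle>x, y\<rangle>\<bar>\<^sup>2\<close> (\<open>nuclear_dist_rank_one\<close>), which equals
  \<open>\<parallel>u\<parallel>\<^sup>2 \<parallel>v\<parallel>\<^sup>2 - (inner v (\<i> u))\<^sup>2 = \<parallel>u\<parallel>\<^sup>2 \<parallel>w\<parallel>\<^sup>2\<close> (\<open>nuclear_dist_orthogonal_component\<close>). Dividing by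
  \<open>\<parallel>u\<parallel> \<parallel>w\<parallel>\<close>, the optimal Lipschitz constants are thus the extreme values of \<open>\<parallel>\<beta>(u, w)\<parallel>\<close> over unit
  vectors \<open>u\<close>, \<open>w\<close> with \<open>w\<close> orthogonal to \<open>\<i> u\<close>. For fixed \<open>u\<close> the largest value of \<open>\<parallel>\<beta>(u, w)\<parallel>\<^sup>2\<close>
  is the norm of \<open>R(\<xi>)\<close>. For fixed \<open>u\<close> the smallest value of \<open>\<parallel>\<beta>(u, w)\<parallel>\<^sup>2\<close> is the smallest
  eigenvalue of \<open>R(\<xi>)\<close> on the orthogonal complement of its null vector \<open>J \<xi>\<close>, which is the next to
  the smallest eigenvalue of \<open>R(\<xi>)\<close> (\<open>next_smallest_eigenvalue_R_realify\<close>).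

  All extrema exist by compactness of the set of admissible pairs \<open>(u, w)\<close>. Injectivity of \<open>\<alpha>\<close>
  says that \<open>\<beta>(u, v) = 0\<close> only if \<open>x\<close> and \<open>y\<close> differ by a phase, that is, if the nuclear distance
  is \<open>0\<close>; hence the attained minimum \<open>A0 c f\<close> is positive (\<open>A0_pos\<close>).
\<close>

section \<open>Eigenbases of symmetric operators\<close>

text \<open>
  For a positive semidefinite form, \<open>\<langle>S v, v\<rangle> = 0\<close> forces \<open>S v = 0\<close>: the form is nonnegative on
  the line through \<open>x\<close> in direction \<open>S x\<close>, and there it is a quadratic polynomial in the parameter
  with constant term \<open>0\<close>, so its linear coefficient, which is \<open>2 \<parallel>S x\<parallel>\<^sup>2\<close>, vanishes.
\<close>

lemma semidefinite_null_vector: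
  fixes S :: "'b::euclidean_space \<Rightarrow> 'b"
  assumes lin: "linear S" and V: "subspace V" and inv: "\<And>v. v \<in> V \<Longrightarrow> S v \<in> V"
    and sym: "\<And>v w. v \<in> V \<Longrightarrow> w \<in> V \<Longrightarrow> inner (S v) w = inner v (S w)"
    and pos: "\<And>v. v \<in> V \<Longrightarrow> inner (S v) v \<ge> 0"
    and x: "x \<in> V" "inner (S x) x = 0"
  shows "S x = 0"
proof -
  define y where "y = S x"
  define a where "a = inner y y"
  define b where "b = inner (S y) y"
  have yV: "y \<in> V" using x inv by (simp add: y_def)
  have b: "b \<ge> 0" using pos yV by (simp add: b_def)
  have ge: "2 * t * a + t\<^sup>2 * b \<ge> 0" for t
  proof -
    have "inner (S (x + t *\<^sub>R y)) (x + t *\<^sub>R y) \<ge> 0"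
      using pos V x yV by (simp add: subspace_add subspace_scale)
    moreover have "inner (S y) x = a"
      using sym [OF yV x(1)] by (simp add: a_def y_def)
    ultimately show ?thesis
      using x(2) lin
      by (simp add: linear_add linear_scale inner_add_left inner_add_right a_def b_def
          power2_eq_square algebra_simps flip: y_def)
  qed
  \<comment> \<open>The minimiser of the quadratic is \<open>- a / b\<close>; the shift by \<open>1\<close> covers \<open>b = 0\<close> as well.\<close>
  have "2 * (- a / (b + 1)) * a + (- a / (b + 1))\<^sup>2 * b = - (a\<^sup>2 * (b + 2)) / (b + 1)\<^sup>2"
    using b by (simp add: divide_simps power2_eq_square) (simp add: algebra_simps)
  with ge [of "- a / (b + 1)"] have "a\<^sup>2 * (b + 2) / (b + 1)\<^sup>2 \<le> 0" by simp
  then have "a\<^sup>2 * (b + 2) \<le> 0"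
    using b by (simp add: divide_le_0_iff)
  then have "a = 0"
    using b by (smt (verit, best) mult_pos_pos zero_less_power2)
  then show ?thesis by (simp add: a_def y_def)
qed

text \<open>
  A unit vector that maximises \<open>\<langle>T x, x\<rangle>\<close>, with maximum \<open>l\<close>, is an eigenvector: \<open>l - T\<close> is
  positive semidefinite and its form vanishes at the maximiser.
\<close>

lemma symmetric_operator_has_eigenvector:
  fixes T :: "'b::euclidean_space \<Rightarrow> 'b"
  assumes lin: "linear T" and V: "subspace V" "V \<noteq> {0}" and inv: "\<And>v. v \<in> V \<Longrightarrow> T v \<in> V"
    and sym: "\<And>v w. v \<in> V \<Longrightarrow> w \<in> V \<Longrightarrow> inner (T v) w = inner v (T w)"
  obtains x l where "x \<in> V" "norm x = 1" "T x = l *\<^sub>R x"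
proof -
  let ?S = "V \<inter> sphere 0 1"
  obtain v where v: "v \<in> V" "v \<noteq> 0" using V subspace_0 by blast
  then have "v /\<^sub>R norm v \<in> ?S" using V by (simp add: subspace_scale)
  then have ne: "?S \<noteq> {}" by blast
  have "compact ?S"
    by (simp add: closed_Int_compact closed_subspace V)
  moreover have "continuous_on ?S (\<lambda>x. inner (T x) x)"
    using lin by (intro continuous_intros linear_continuous_on linear_conv_bounded_linear [THEN iffD1])
  ultimately have "\<exists>x\<in>?S. \<forall>y\<in>?S. inner (T y) y \<le> inner (T x) x"
    using ne by (intro continuous_attains_sup)
  then obtain x where x: "x \<in> ?S" and max: "\<And>y. y \<in> ?S \<Longrightarrow> inner (T y) y \<le> inner (T x) x"
    by (elim bexE) simp
  define l where "l = inner (T x) x"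
  define S where "S = (\<lambda>y. l *\<^sub>R y - T y)"
  have "S x = 0"
  proof (rule semidefinite_null_vector [where V = V and S = S and x = x])
    show "linear S"
      unfolding S_def using lin by (intro linear_compose_sub linear_compose_scale_right linear_ident)
    show "S v \<in> V" if "v \<in> V" for v
      using that V inv by (simp add: S_def subspace_diff subspace_scale)
    show "inner (S v) w = inner v (S w)" if "v \<in> V" "w \<in> V" for v w
      using sym [OF that] by (simp add: S_def inner_diff_left inner_diff_right)
    show "inner (S v) v \<ge> 0" if "v \<in> V" for v
    proof (cases "v = 0")
      case False
      define w where "w = v /\<^sub>R norm v"
      have "w \<in> ?S" using that V False by (simp add: w_def subspace_scale)
      then have "inner (T w) w \<le> l" using max by (simp add: l_def)
      moreover have "v = norm v *\<^sub>R w" using False by (simp add: w_def)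
      then have "inner (T v) v = inner (T (norm v *\<^sub>R w)) (norm v *\<^sub>R w)" by (simp only:)
      then have "inner (T v) v = (norm v)\<^sup>2 * inner (T w) w"
        by (simp only: inner_scaleR_left inner_scaleR_right linear_scale [OF lin] power2_eq_square mult.assoc)
      ultimately have "inner (T v) v \<le> (norm v)\<^sup>2 * l"
        by (simp add: mult_left_mono)
      then show ?thesis
        by (simp add: S_def inner_diff_left dot_square_norm mult.commute)
    qed auto
    show "inner (S x) x = 0"
      using x by (simp add: S_def inner_diff_left dot_square_norm flip: l_def)
  qed (use V x in auto)
  then have "T x = l *\<^sub>R x" by (simp add: S_def)
  then show thesis using that [of x l] x by simp
qed

definition orthonormal_eigenbasis ::
  "'b::euclidean_space set \<Rightarrow> ('b \<Rightarrow> 'b) \<Rightarrow> ('b \<Rightarrow> real) \<Rightarrow> 'b set \<Rightarrow> bool" where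
  "orthonormal_eigenbasis V T lam B \<longleftrightarrow>
     finite B \<and> pairwise orthogonal B \<and> span B = V \<and> (\<forall>b\<in>B. norm b = 1 \<and> T b = lam b *\<^sub>R b)"

text \<open>
  The step by which eigenbases grow. It gives the spectral theorem by induction, and it also
  allows an eigenvector that is known beforehand to be made a member of the basis.
\<close>

lemma orthonormal_eigenbasis_insert:
  fixes T :: "'b::euclidean_space \<Rightarrow> 'b"
  assumes V: "subspace V" and x: "x \<in> V" "norm x = 1" "T x = l *\<^sub>R x"
    and B: "orthonormal_eigenbasis {v \<in> V. inner v x = 0} T lam B"
  shows "x \<notin> B \<and> orthonormal_eigenbasis V T (lam(x := l)) (insert x B)"
proof -
  let ?W = "{v \<in> V. inner v x = 0}"
  have BW: "B \<subseteq> ?W" and spanB: "span B = ?W"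
    using B span_superset [of B] by (auto simp: orthonormal_eigenbasis_def)
  have nx: "x \<notin> B" using x(2) BW by (auto simp: dot_square_norm)
  have "span (insert x B) = V"
  proof
    show "span (insert x B) \<subseteq> V" using BW x V by (intro span_minimal) auto
    show "V \<subseteq> span (insert x B)"
    proof
      fix v assume v: "v \<in> V"
      have "v - inner v x *\<^sub>R x \<in> ?W"
        using v x V by (simp add: subspace_diff subspace_scale inner_diff_left dot_square_norm)
      then show "v \<in> span (insert x B)"
        using spanB by (auto simp: span_insert)
    qed
  qed
  then have "orthonormal_eigenbasis V T (lam(x := l)) (insert x B)"
    using B BW x nx
    by (auto simp: orthonormal_eigenbasis_def pairwise_insert orthogonal_def inner_commute)
  with nx show ?thesis by blast
qed

theorem symmetric_operator_eigenbasis: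
  fixes T :: "'b::euclidean_space \<Rightarrow> 'b"
  assumes lin: "linear T" and V: "subspace V" and inv: "\<And>v. v \<in> V \<Longrightarrow> T v \<in> V"
    and sym: "\<And>v w. v \<in> V \<Longrightarrow> w \<in> V \<Longrightarrow> inner (T v) w = inner v (T w)"
  shows "\<exists>B lam. orthonormal_eigenbasis V T lam B"
  using V inv sym
proof (induction "dim V" arbitrary: V rule: less_induct)
  case less
  show ?case
  proof (cases "V = {0}")
    case True
    then have "orthonormal_eigenbasis V T (\<lambda>_. 0) {}" by (simp add: orthonormal_eigenbasis_def)
    then show ?thesis by blast
  next
    case False
    obtain x l where x: "x \<in> V" "norm x = 1" "T x = l *\<^sub>R x"
      using symmetric_operator_has_eigenvector [OF lin less.prems(1) False less.prems(2,3)] by blast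
    let ?W = "{v \<in> V. inner v x = 0}"
    have W: "subspace ?W"
      using less.prems(1) by (auto simp: subspace_def inner_add_left)
    have "x \<notin> ?W" using x by (auto simp: dot_square_norm)
    then have "?W \<subset> V" using x by blast
    moreover have "span ?W = ?W" "span V = V"
      using W less.prems(1) by (simp_all only: span_eq_iff)
    ultimately have "dim ?W < dim V"
      using dim_psubset [of ?W V] by (simp only:)
    moreover have "T v \<in> ?W" if v: "v \<in> ?W" for v
    proof -
      have "inner (T v) x = l * inner v x"
        using less.prems(3) [of v x] v x by simp
      then show ?thesis using v less.prems(2) by simp
    qed
    moreover have "inner (T v) w = inner v (T w)" if "v \<in> ?W" "w \<in> ?W" for v w
      using that less.prems(3) by simp
    ultimately have "\<exists>B lam. orthonormal_eigenbasis ?W T lam B"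
      using less.hyps [OF _ W] by (simp only:)
    then obtain B lam where B: "orthonormal_eigenbasis ?W T lam B" by blast
    show ?thesis
      by (intro exI, rule conjunct2 [OF orthonormal_eigenbasis_insert [where T = T and V = V
            and lam = lam and B = B, OF less.prems(1) x B]])
  qed
qed

lemma orthonormal_eigenbasis_expand:
  assumes B: "orthonormal_eigenbasis V T lam B" and v: "v \<in> V"
  shows "(\<Sum>b\<in>B. inner v b *\<^sub>R b) = v"
  by (rule orthonormal_basis_expand) (use B v in \<open>simp_all add: orthonormal_eigenbasis_def\<close>)

lemma orthonormal_eigenbasis_parseval:
  assumes B: "orthonormal_eigenbasis V T lam B" and v: "v \<in> V"
  shows "(\<Sum>b\<in>B. inner b v * inner b w) = inner v w"
proof -
  have "inner v w = inner (\<Sum>b\<in>B. inner v b *\<^sub>R b) w"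
    using orthonormal_eigenbasis_expand [OF assms] by simp
  also have "\<dots> = (\<Sum>b\<in>B. inner b v * inner b w)"
    unfolding inner_sum_left by (simp add: inner_commute)
  finally show ?thesis by simp
qed

lemma orthonormal_eigenbasis_independent:
  assumes "orthonormal_eigenbasis V T lam B"
  shows "independent B"
proof (rule pairwise_orthogonal_independent)
  show "pairwise orthogonal B" "0 \<notin> B"
    using assms by (auto simp: orthonormal_eigenbasis_def)
qed

text \<open>
  In an eigenbasis the quadratic form of \<open>T\<close> is \<open>\<Sum>\<^sub>b lam b \<langle>b, v\<rangle>\<^sup>2\<close>, so the smallest eigenvalue is
  a lower bound for it on unit vectors.
\<close>

lemma eigenbasis_Min_le:
  assumes B: "orthonormal_eigenbasis V T lam B" and lin: "linear T" and v: "v \<in> V"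
  shows "Min (lam ` B) * inner v v \<le> inner (T v) v"
proof -
  have B': "finite B" "\<And>b. b \<in> B \<Longrightarrow> T b = lam b *\<^sub>R b"
    using B by (auto simp: orthonormal_eigenbasis_def)
  have "inner (T v) v = inner (T (\<Sum>b\<in>B. inner v b *\<^sub>R b)) v"
    by (simp only: orthonormal_eigenbasis_expand [OF B v])
  also have "\<dots> = (\<Sum>b\<in>B. lam b * (inner b v * inner b v))"
    by (simp add: linear_sum [OF lin] linear_scale [OF lin] B' inner_sum_left inner_commute [of v] mult_ac
        cong: sum.cong)
  also have "\<dots> \<ge> (\<Sum>b\<in>B. Min (lam ` B) * (inner b v * inner b v))"
    using B'(1) by (intro sum_mono mult_right_mono) auto
  finally show ?thesis
    by (simp add: orthonormal_eigenbasis_parseval [OF B v] flip: sum_distrib_left)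
qed

lemma eigenspace_on_eigenbasis:
  fixes T :: "'b::euclidean_space \<Rightarrow> 'b"
  assumes B: "orthonormal_eigenbasis V T lam B" and lin: "linear T"
  shows "eigenspace_on V T l = span {b \<in> B. lam b = l}"
proof
  have B': "finite B" "span B = V" "\<And>b. b \<in> B \<Longrightarrow> T b = lam b *\<^sub>R b"
    using B by (auto simp: orthonormal_eigenbasis_def)
  show "span {b \<in> B. lam b = l} \<subseteq> eigenspace_on V T l"
  proof (rule span_minimal)
    show "{b \<in> B. lam b = l} \<subseteq> eigenspace_on V T l"
      using B' span_superset by (auto simp: eigenspace_on_def)
    have "subspace V" using B' subspace_span by metis
    then show "subspace (eigenspace_on V T l)"
      using lin by (auto simp: subspace_def eigenspace_on_def linear_add linear_scale linear_0
          scaleR_add_right mult.commute)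
  qed
  show "eigenspace_on V T l \<subseteq> span {b \<in> B. lam b = l}"
  proof
    fix v assume "v \<in> eigenspace_on V T l"
    then have v: "v \<in> V" "T v = l *\<^sub>R v" by (auto simp: eigenspace_on_def)
    have e: "v = (\<Sum>b\<in>B. inner v b *\<^sub>R b)" using orthonormal_eigenbasis_expand [OF B v(1)] by simp
    have "T v = (\<Sum>b\<in>B. inner v b *\<^sub>R lam b *\<^sub>R b)"
      by (subst e) (simp add: linear_sum [OF lin] linear_scale [OF lin] B')
    with v(2) e have "(\<Sum>b\<in>B. inner v b *\<^sub>R lam b *\<^sub>R b) - l *\<^sub>R (\<Sum>b\<in>B. inner v b *\<^sub>R b) = 0"
      by simp
    then have "(\<Sum>b\<in>B. (inner v b * (lam b - l)) *\<^sub>R b) = 0"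
      by (simp add: scaleR_sum_right algebra_simps flip: sum_subtractf)
    then have "inner v b * (lam b - l) = 0" if "b \<in> B" for b
      using that by (rule independentD [OF orthonormal_eigenbasis_independent [OF B] B'(1) subset_refl])
    then have 0: "inner v b = 0 \<or> lam b = l" if "b \<in> B" for b
      using that by (simp only: mult_eq_0_iff right_minus_eq)
    have "inner v b *\<^sub>R b \<in> span {b \<in> B. lam b = l}" if "b \<in> B" for b
    proof (cases "lam b = l")
      case True
      with that show ?thesis by (intro span_scale span_base) simp
    next
      case False
      with 0 [OF that] show ?thesis by (simp add: span_zero)
    qed
    then show "v \<in> span {b \<in> B. lam b = l}"
      by (subst e) (rule span_sum)
  qed
qed

lemma eigenbasis_dim_eigenspace:
  fixes T :: "'b::euclidean_space \<Rightarrow> 'b"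
  assumes B: "orthonormal_eigenbasis V T lam B" and lin: "linear T"
  shows "dim (eigenspace_on V T l) = card {b \<in> B. lam b = l}"
proof -
  have "independent {b \<in> B. lam b = l}"
    using orthonormal_eigenbasis_independent [OF B] by (rule independent_mono) auto
  then show ?thesis
    using dim_eq_card_independent by (simp only: eigenspace_on_eigenbasis [OF B lin] dim_span)
qed

lemma eigenvalues_on_eigenbasis:
  fixes T :: "'b::euclidean_space \<Rightarrow> 'b"
  assumes B: "orthonormal_eigenbasis V T lam B" and lin: "linear T"
  shows "eigenvalues_on V T = lam ` B"
proof -
  have "0 \<notin> B" using B by (auto simp: orthonormal_eigenbasis_def)
  have "(\<exists>x\<noteq>0. x \<in> span {b \<in> B. lam b = l}) \<longleftrightarrow> l \<in> lam ` B" for l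
  proof
    assume "\<exists>x\<noteq>0. x \<in> span {b \<in> B. lam b = l}"
    then have "{b \<in> B. lam b = l} \<noteq> {}" by (metis singletonD span_empty)
    then show "l \<in> lam ` B" by auto
  next
    assume "l \<in> lam ` B"
    then obtain b where "b \<in> B" "lam b = l" by auto
    then show "\<exists>x\<noteq>0. x \<in> span {b \<in> B. lam b = l}"
      using \<open>0 \<notin> B\<close> by (intro exI [of _ b]) (auto intro: span_base)
  qed
  then show ?thesis
    by (auto simp: eigenvalues_on_def eigenspace_on_eigenbasis [OF B lin])
qed

lemma eigenvalue_mset_eigenbasis:
  fixes T :: "'b::euclidean_space \<Rightarrow> 'b"
  assumes B: "orthonormal_eigenbasis V T lam B" and lin: "linear T"
  shows "eigenvalue_mset V T = image_mset lam (mset_set B)"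
proof (rule multiset_eqI)
  fix l
  have fin: "finite B" using B by (simp add: orthonormal_eigenbasis_def)
  have "count (eigenvalue_mset V T) l =
      (\<Sum>l'\<in>lam ` B. if l = l' then card {b \<in> B. lam b = l'} else 0)"
    by (simp add: eigenvalue_mset_def eigenvalues_on_eigenbasis [OF B lin] count_sum
        eigenbasis_dim_eigenspace [OF B lin])
  also have "\<dots> = card {b \<in> B. lam b = l}"
    using fin by (simp add: sum.delta) (metis (mono_tags, lifting) imageI)
  also have "\<dots> = count (image_mset lam (mset_set B)) l"
    using fin by (simp add: count_image_mset_eq_card_vimage)
  finally show "count (eigenvalue_mset V T) l = count (image_mset lam (mset_set B)) l" .
qed

text \<open>
  When a positive semidefinite operator has a null vector \<open>x\<close>, its smallest eigenvalue is the \<open>0\<close>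
  of \<open>x\<close>, and the remaining eigenvalues are those on the orthogonal complement of \<open>x\<close>. Hence the
  next to the smallest one is the minimum over that complement. This is how the index \<open>2 n - 1\<close> in
  the lower Lipschitz bound enters: \<open>R(\<xi>)\<close> always annihilates \<open>J \<xi>\<close>.
\<close>

lemma next_smallest_eigenvalue_eq_Min:
  fixes T :: "'b::euclidean_space \<Rightarrow> 'b"
  assumes lin: "linear T" and V: "subspace V"
    and x: "x \<in> V" "norm x = 1" "T x = 0"
    and B: "orthonormal_eigenbasis {v \<in> V. inner v x = 0} T lam B"
    and nonneg: "\<And>b. b \<in> B \<Longrightarrow> lam b \<ge> 0" and d: "dim V \<ge> 2"
  shows "nth_eigenvalue V T (dim V - 1) = Min (lam ` B)"
proof -
  have B': "orthonormal_eigenbasis V T (lam(x := 0)) (insert x B)" and nx: "x \<notin> B"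
    using orthonormal_eigenbasis_insert [OF V x(1,2) _ B, of 0] x(3) by auto
  have fin: "finite B" using B by (simp add: orthonormal_eigenbasis_def)
  have "card (insert x B) = dim V"
    using B' orthonormal_eigenbasis_independent [OF B'] dim_span_eq_card_independent
    by (metis orthonormal_eigenbasis_def)
  then have card: "dim V = Suc (card B)" using nx fin by simp
  define M where "M = image_mset lam (mset_set B)"
  have M: "\<And>l. l \<in># M \<Longrightarrow> l \<ge> 0" "size M = card B" "set_mset M = lam ` B"
    using nonneg fin by (auto simp: M_def)
  have "image_mset (lam(x := 0)) (mset_set B) = M"
    unfolding M_def using nx fin by (intro image_mset_cong) auto
  then have ev: "eigenvalue_mset V T = add_mset 0 M"
    using eigenvalue_mset_eigenbasis [OF B' lin] nx fin by simp
  define L where "L = sorted_list_of_multiset M"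
  have L: "mset L = M" "set L = lam ` B" "sorted L" "length L = card B"
    using M by (auto simp: L_def simp flip: size_mset)
  have "insort 0 L = 0 # L"
    using M(1) L(1) by (cases L) (auto simp flip: L(1))
  then have "eigenvalue_list V T = rev L @ [0]"
    by (simp add: eigenvalue_list_def ev flip: L_def)
  moreover have "dim V - 1 - 1 < length L" using d card L by simp
  ultimately have "nth_eigenvalue V T (dim V - 1) = L ! 0"
    using card L(4) by (simp add: nth_eigenvalue_def nth_append rev_nth)
  also have "L ! 0 = Min (set L)"
    using L(3) \<open>dim V - 1 - 1 < length L\<close> by (cases L) (auto intro: Min_eqI [symmetric])
  finally show ?thesis using L(2) by simp
qed


section \<open>Real and complex structure of a complex Euclidean space\<close>

lemma scaleR_eq_scaleC: "r *\<^sub>R (x :: 'a::complex_euclidean_space) = complex_of_real r *\<^sub>C x"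
  by (simp add: scaleC_of_real)

lemma linear_scaleC: "linear (\<lambda>v :: 'a::complex_euclidean_space. a *\<^sub>C v)"
  by (rule linearI) (simp_all add: scaleC_add_right scaleR_eq_scaleC scaleC_scaleC mult.commute)

lemma linear_cinner: "linear (\<lambda>v :: 'a::complex_euclidean_space. cinner v w)"
  by (rule linearI) (simp_all add: cinner_add_left cinner_scaleC_left scaleR_conv_of_real flip: scaleC_of_real)

lemma cinner_diff_left: "cinner (x - y) z = cinner x z - cinner (y :: 'a::complex_euclidean_space) z"
  by (rule linear_diff [OF linear_cinner])

lemma cinner_diff_right: "cinner z (x - y) = cinner z x - cinner z (y :: 'a::complex_euclidean_space)"
  by (metis cinner_commute cinner_diff_left complex_cnj_diff)

lemma cinner_self: "cinner x x = complex_of_real ((norm (x :: 'a::complex_euclidean_space))\<^sup>2)"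
proof -
  have "Im (cinner x x) = 0"
    using arg_cong [OF cinner_commute [of x x], of Im] by simp
  then show ?thesis by (simp add: complex_eq_iff Re_cinner dot_square_norm)
qed

lemma Im_cinner: "Im (cinner x y) = inner x (\<i> *\<^sub>C (y :: 'a::complex_euclidean_space))"
  by (simp add: cinner_scaleC_right flip: Re_cinner)

lemma inner_scaleC_unit:
  assumes "cmod a = 1"
  shows "inner (a *\<^sub>C x) (a *\<^sub>C y) = inner x (y :: 'a::complex_euclidean_space)"
proof -
  have "cnj a * a = 1" using assms complex_norm_square [of a] by (simp add: mult.commute)
  then have "cinner (a *\<^sub>C x) (a *\<^sub>C y) = cinner x y"
    by (simp add: cinner_scaleC_left cinner_scaleC_right flip: mult.assoc)
  then show ?thesis by (simp flip: Re_cinner)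
qed

lemma inner_ii: "inner (\<i> *\<^sub>C x) (\<i> *\<^sub>C y) = inner x (y :: 'a::complex_euclidean_space)"
  by (simp add: inner_scaleC_unit)

lemma inner_i_self: "inner x (\<i> *\<^sub>C (x :: 'a::complex_euclidean_space)) = 0"
  using Im_cinner [of x x] by (simp add: cinner_self)

lemma norm_scaleC_unit: "cmod a = 1 \<Longrightarrow> norm (a *\<^sub>C (x :: 'a::complex_euclidean_space)) = norm x"
  by (simp add: norm_eq_sqrt_inner inner_scaleC_unit)

text \<open>
  Multiplying \<open>x\<close> by a phase makes \<open>\<langle>x, y\<rangle>\<close> real and nonnegative without changing its modulus,
  which reduces the claim to the real inequality.
\<close>

lemma cinner_Cauchy_Schwarz:
  "cmod (cinner x y) \<le> norm x * norm (y :: 'a::complex_euclidean_space)"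
proof (cases "cinner x y = 0")
  case False
  define u where "u = cnj (cinner x y) / cmod (cinner x y)"
  have u: "cmod u = 1" using False by (simp add: u_def norm_divide)
  have "cinner (u *\<^sub>C x) y = complex_of_real (cmod (cinner x y))"
    using False complex_norm_square [of "cinner x y"]
    by (simp add: cinner_scaleC_left u_def field_simps power2_eq_square)
  then have "cmod (cinner x y) = inner (u *\<^sub>C x) y"
    by (simp flip: Re_cinner)
  also have "\<dots> \<le> norm (u *\<^sub>C x) * norm y" by (rule norm_cauchy_schwarz)
  finally show ?thesis by (simp add: norm_scaleC_unit [OF u])
qed simp

lemma complex_subspace_imp_subspace:
  "complex_vs.subspace S \<Longrightarrow> subspace (S :: 'a::complex_euclidean_space set)"
  by (simp add: subspace_def complex_vs.subspace_def scaleR_eq_scaleC)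

lemma cspan_eq_span:
  fixes C :: "'a::complex_euclidean_space set"
  shows "cspan C = span (C \<union> (*\<^sub>C) \<i> ` C)"
proof
  let ?X = "C \<union> (*\<^sub>C) \<i> ` C"
  show "span ?X \<subseteq> cspan C"
    by (intro span_minimal complex_subspace_imp_subspace complex_vs.subspace_span)
      (auto intro: complex_vs.span_base complex_vs.span_scale)
  have i: "\<i> *\<^sub>C v \<in> span ?X" if "v \<in> span ?X" for v
  proof -
    have "\<i> *\<^sub>C v \<in> (*\<^sub>C) \<i> ` span ?X" using that by blast
    also have "\<dots> = span ((*\<^sub>C) \<i> ` ?X)"
      by (rule linear_span_image [OF linear_scaleC, symmetric])
    also have "\<dots> \<subseteq> span ?X"
    proof (intro span_minimal subspace_span)
      have "- v \<in> span ?X" if "v \<in> C" for v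
        using span_neg [OF span_base [of v ?X]] that by simp
      then show "(*\<^sub>C) \<i> ` ?X \<subseteq> span ?X"
        by (auto simp: scaleC_scaleC intro: span_base)
    qed
    finally show ?thesis .
  qed
  have "a *\<^sub>C v \<in> span ?X" if "v \<in> span ?X" for a v
  proof -
    have "a *\<^sub>C v = Re a *\<^sub>R v + Im a *\<^sub>R \<i> *\<^sub>C v"
      by (simp add: scaleR_eq_scaleC scaleC_scaleC mult.commute
          flip: scaleC_add_left complex_eq)
    then show ?thesis using i that by (simp add: span_add span_scale)
  qed
  then have "complex_vs.subspace (span ?X)"
    by (auto simp: complex_vs.subspace_def span_add span_zero)
  then show "cspan C \<subseteq> span ?X"
    by (intro complex_vs.span_minimal) (auto intro: span_base)
qed

lemma dim_complex_independent:
  fixes C :: "'a::complex_euclidean_space set"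
  assumes "finite C" "complex_vs.independent C"
  shows "dim (cspan C) = 2 * card C"
  using assms
proof (induction C)
  case (insert e C)
  let ?X = "C \<union> (*\<^sub>C) \<i> ` C"
  have ind: "complex_vs.independent C" and e: "e \<notin> cspan C"
    using insert.prems insert.hyps by (auto simp: complex_vs.independent_insert)
  have "\<i> *\<^sub>C e \<notin> span (insert e ?X)"
  proof
    assume "\<i> *\<^sub>C e \<in> span (insert e ?X)"
    then obtain k where "\<i> *\<^sub>C e - k *\<^sub>R e \<in> cspan C"
      by (auto simp: span_insert cspan_eq_span)
    then have "(\<i> - complex_of_real k) *\<^sub>C e \<in> cspan C"
      by (simp add: scaleR_eq_scaleC complex_vs.scale_left_diff_distrib)
    then have "inverse (\<i> - complex_of_real k) *\<^sub>C (\<i> - complex_of_real k) *\<^sub>C e \<in> cspan C"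
      by (rule complex_vs.span_scale)
    moreover have "\<i> - complex_of_real k \<noteq> 0" by (simp add: complex_eq_iff)
    ultimately show False using e by (simp add: scaleC_scaleC)
  qed
  then have "dim (insert (\<i> *\<^sub>C e) (insert e ?X)) = dim ?X + 2"
    using e by (simp add: dim_insert cspan_eq_span)
  moreover have "insert e C \<union> (*\<^sub>C) \<i> ` insert e C = insert (\<i> *\<^sub>C e) (insert e ?X)" by auto
  moreover have "dim ?X = 2 * card C" using insert.IH [OF ind] by (simp add: cspan_eq_span)
  ultimately show ?case using insert.hyps by (simp add: cspan_eq_span)
qed simp

text \<open>
  If \<open>C\<close> is a complex basis, then \<open>C\<close> together with \<open>\<i> C\<close> is a real basis. Through this relation
  the multiplicities of singular values, which are complex dimensions, can be read off from a real
  eigenbasis.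
\<close>

lemma dim_eq_twice_cdim:
  fixes S :: "'a::complex_euclidean_space set"
  assumes S: "complex_vs.subspace S"
  shows "dim S = 2 * cdim S"
proof -
  obtain C where C: "C \<subseteq> S" "complex_vs.independent C" "S \<subseteq> cspan C" "card C = cdim S"
    using complex_vs.basis_exists by blast
  have "finite C"
  proof -
    have "card F \<le> DIM('a)" if "F \<subseteq> C" "finite F" for F
    proof -
      have "2 * card F = dim (cspan F)"
        using dim_complex_independent [OF that(2)] complex_vs.independent_mono [OF C(2) that(1)] by simp
      also have "\<dots> \<le> DIM('a)" by (rule dim_subset_UNIV)
      finally show ?thesis by simp
    qed
    then show ?thesis using finite_if_finite_subsets_card_bdd by blast
  qed
  moreover have "cspan C = S" using C S complex_vs.span_minimal by blast
  ultimately show ?thesis using dim_complex_independent C by metis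
qed


section \<open>The nuclear distance of rank-one operators\<close>

lemma cadjoint_selfadjoint:
  fixes T :: "'a::complex_euclidean_space \<Rightarrow> 'a"
  assumes sa: "\<And>x y. cinner (T x) y = cinner x (T y)"
  shows "cadjoint T = T"
  unfolding cadjoint_def
proof (rule some_equality)
  fix T' assume T': "\<forall>x y. cinner (T x) y = cinner x (T' y)"
  have "T' y = T y" for y
  proof -
    have "inner x (T' y - T y) = 0" for x
      using T' sa [of x y] by (simp add: cinner_diff_right flip: Re_cinner)
    then show ?thesis by (metis inner_eq_zero_iff right_minus_eq)
  qed
  then show "T' = T" by blast
qed (use sa in blast)

text \<open>
  A complex self-adjoint operator is symmetric for the real inner product, so it has a real
  orthonormal eigenbasis. Its singular values are the moduli of its eigenvalues, and each complex
  dimension counts as two vectors of the basis, whence the factor \<open>2\<close>.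
\<close>

lemma nuclear_norm_selfadjoint:
  fixes T :: "'a::complex_euclidean_space \<Rightarrow> 'a"
  assumes add: "\<And>v w. T (v + w) = T v + T w" and scale: "\<And>a v. T (a *\<^sub>C v) = a *\<^sub>C T v"
    and sa: "\<And>v w. cinner (T v) w = cinner v (T w)"
    and B: "orthonormal_eigenbasis UNIV T mu B"
  shows "2 * nuclear_norm T = (\<Sum>b\<in>B. \<bar>mu b\<bar>)"
proof -
  have lin: "linear (T \<circ> T)"
    by (rule linearI) (simp_all add: add scale scaleR_eq_scaleC)
  have fin: "finite B" using B by (simp add: orthonormal_eigenbasis_def)
  have B2: "orthonormal_eigenbasis UNIV (T \<circ> T) (\<lambda>b. (mu b)\<^sup>2) B"
    using B by (auto simp: orthonormal_eigenbasis_def scale scaleR_eq_scaleC scaleC_scaleC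
        power2_eq_square)
  have sp: "singular_space T s = eigenspace_on UNIV (T \<circ> T) (s\<^sup>2)" for s
    unfolding singular_space_def eigenspace_on_def cadjoint_selfadjoint [OF sa] scaleR_eq_scaleC
    by simp
  have "complex_vs.subspace (singular_space T s)" for s
    unfolding singular_space_def cadjoint_selfadjoint [OF sa]
  proof (rule complex_vs.subspaceI)
    have "T 0 = 0" using scale [of 0 0] by simp
    then show "0 \<in> {v. T (T v) = complex_of_real (s\<^sup>2) *\<^sub>C v}" by simp
  qed (auto simp: add scale scaleC_add_right scaleC_scaleC mult.commute)
  then have dims: "2 * cdim (singular_space T s) = card {b \<in> B. (mu b)\<^sup>2 = s\<^sup>2}" for s
    using dim_eq_twice_cdim eigenbasis_dim_eigenspace [OF B2 lin] sp by metis
  have sq: "(mu b)\<^sup>2 = s\<^sup>2 \<longleftrightarrow> \<bar>mu b\<bar> = s" if "s \<ge> 0" for s b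
    using that by (metis abs_ge_zero power2_abs power2_eq_iff_nonneg)
  have "(\<exists>v\<noteq>0. v \<in> singular_space T s) \<longleftrightarrow> s\<^sup>2 \<in> (\<lambda>b. (mu b)\<^sup>2) ` B" for s
    using eigenvalues_on_eigenbasis [OF B2 lin] by (auto simp: eigenvalues_on_def sp)
  then have "singular_values T = {s. s \<ge> 0 \<and> s\<^sup>2 \<in> (\<lambda>b. (mu b)\<^sup>2) ` B}"
    by (simp add: singular_values_def)
  also have "\<dots> = (\<lambda>b. \<bar>mu b\<bar>) ` B"
  proof -
    have "s\<^sup>2 = (mu b)\<^sup>2 \<longleftrightarrow> s = \<bar>mu b\<bar>" if "s \<ge> 0" for s b
      using sq [OF that, of b] by (simp only: eq_commute)
    then show ?thesis by (auto simp: image_iff)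
  qed
  finally have sv: "singular_values T = (\<lambda>b. \<bar>mu b\<bar>) ` B" .
  have "2 * nuclear_norm T = (\<Sum>s\<in>(\<lambda>b. \<bar>mu b\<bar>) ` B. real (2 * cdim (singular_space T s)) * s)"
    by (simp add: nuclear_norm_def sv sum_distrib_left mult.assoc)
  also have "\<dots> = (\<Sum>s\<in>(\<lambda>b. \<bar>mu b\<bar>) ` B. \<Sum>b | b \<in> B \<and> \<bar>mu b\<bar> = s. \<bar>mu b\<bar>)"
  proof (rule sum.cong [OF refl])
    fix s assume "s \<in> (\<lambda>b. \<bar>mu b\<bar>) ` B"
    then have "s \<ge> 0" by auto
    then show "real (2 * cdim (singular_space T s)) * s = (\<Sum>b | b \<in> B \<and> \<bar>mu b\<bar> = s. \<bar>mu b\<bar>)"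
      unfolding dims by (simp add: sq)
  qed
  also have "\<dots> = (\<Sum>b\<in>B. \<bar>mu b\<bar>)"
    using sum.image_gen [OF fin, symmetric] .
  finally show ?thesis .
qed

text \<open>
  The real trace of \<open>v \<mapsto> \<langle>v, s\<rangle> t\<close> is twice the real part of its complex trace \<open>\<langle>t, s\<rangle>\<close>: write
  \<open>\<langle>b, s\<rangle>\<close> as \<open>inner b s + \<i> inner b (\<i> s)\<close> and apply Parseval to both parts.
\<close>

lemma eigenbasis_trace_rank_one:
  fixes s t :: "'a::complex_euclidean_space"
  assumes B: "orthonormal_eigenbasis UNIV T mu B"
  shows "(\<Sum>b\<in>B. inner (cinner b s *\<^sub>C t) b) = 2 * inner s t"
proof -
  have "inner (cinner b s *\<^sub>C t) b = inner b s * inner b t + inner b (\<i> *\<^sub>C s) * inner b (\<i> *\<^sub>C t)" for b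
  proof -
    have "inner (cinner b s *\<^sub>C t) b = Re (cinner b s * cnj (cinner b t))"
      by (simp add: cinner_scaleC_left flip: Re_cinner cinner_commute)
    then show ?thesis by (simp add: Re_cinner Im_cinner)
  qed
  then show ?thesis
    by (simp add: sum.distrib orthonormal_eigenbasis_parseval [OF B] inner_ii)
qed

text \<open>
  The hypothesis says that \<open>m\<close> is \<open>0\<close> or a root of \<open>X\<^sup>2 - t X + d\<close>, whose roots lie on either side
  of \<open>0\<close> because their product is \<open>d \<le> 0\<close>. The square root is the distance of the two roots, and
  its product with the modulus agrees with a quadratic polynomial without constant term at the
  three values that \<open>m\<close> can take. This makes the sum of the moduli of the eigenvalues computable
  from their first two power sums.
\<close>

lemma cubic_root_abs:
  fixes m t d :: real
  assumes m: "m ^ 3 = t * m\<^sup>2 - d * m" and d: "d \<le> 0"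
  shows "sqrt (t\<^sup>2 - 4 * d) * \<bar>m\<bar> = 2 * m\<^sup>2 - t * m"
proof (cases "m = 0")
  case False
  have "m * (m\<^sup>2 - (t * m - d)) = 0"
    using m by (simp add: power3_eq_cube power2_eq_square algebra_simps)
  then have m2: "m\<^sup>2 = t * m - d" using False by simp
  have "(2 * m - t)\<^sup>2 = t\<^sup>2 - 4 * d"
    using m2 by (simp add: power2_eq_square algebra_simps)
  then have "sqrt (t\<^sup>2 - 4 * d) * \<bar>m\<bar> = \<bar>(2 * m - t) * m\<bar>"
    by (metis abs_mult real_sqrt_abs)
  also have "\<dots> = \<bar>m\<^sup>2 - d\<bar>"
    using m2 by (simp add: power2_eq_square algebra_simps)
  also have "\<dots> = m\<^sup>2 - d" using d zero_le_power2 [of m] by linarith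
  finally show ?thesis using m2 by simp
qed simp

text \<open>
  With \<open>D = x x\<^sup>* - y y\<^sup>*\<close>, let \<open>t = \<parallel>x\<parallel>\<^sup>2 - \<parallel>y\<parallel>\<^sup>2\<close> and \<open>d = \<bar>\<langle>x, y\<rangle>\<bar>\<^sup>2 - \<parallel>x\<parallel>\<^sup>2 \<parallel>y\<parallel>\<^sup>2 \<le> 0\<close>. The range of
  \<open>D\<close> lies in the span of \<open>x\<close> and \<open>y\<close>, where \<open>D\<close> satisfies \<open>D\<^sup>2 = t D - d\<close> by Cayley-Hamilton;
  hence \<open>D\<^sup>3 = t D\<^sup>2 - d D\<close> everywhere, and every eigenvalue is a root of \<open>X\<^sup>3 - t X\<^sup>2 + d X\<close>. The
  real traces of \<open>D\<close> and \<open>D\<^sup>2\<close> are \<open>2 t\<close> and \<open>2 (t\<^sup>2 - 2 d)\<close>. These two power sums determine the sum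
  of the moduli of the eigenvalues, which comes out as \<open>2 sqrt (t\<^sup>2 - 4 d)\<close>. Arguing through power
  sums treats linearly dependent and independent \<open>x\<close>, \<open>y\<close> alike.
\<close>

theorem nuclear_dist_rank_one:
  fixes x y :: "'a::complex_euclidean_space"
  shows "nuclear_dist (rank_one x) (rank_one y)
    = sqrt (((norm x)\<^sup>2 + (norm y)\<^sup>2)\<^sup>2 - 4 * (cmod (cinner x y))\<^sup>2)"
proof -
  define D where "D = (\<lambda>v. rank_one x v - rank_one y v)"
  define X Y z where "X = (norm x)\<^sup>2" and "Y = (norm y)\<^sup>2" and "z = cinner x y"
  define t d where "t = X - Y" and "d = (cmod z)\<^sup>2 - X * Y"
  have add: "D (v + w) = D v + D w" for v w
    by (simp add: D_def rank_one_def cinner_add_left scaleC_add_left)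
  have scale: "D (a *\<^sub>C v) = a *\<^sub>C D v" for a v
    by (simp add: D_def rank_one_def cinner_scaleC_left scaleC_scaleC complex_vs.scale_right_diff_distrib)
  have lin: "linear D" by (rule linearI) (simp_all add: add scale scaleR_eq_scaleC)
  have sa: "cinner (D v) w = cinner v (D w)" for v w
    by (simp add: D_def rank_one_def cinner_diff_left cinner_diff_right cinner_scaleC_left
        cinner_scaleC_right mult.commute flip: cinner_commute)
  have sym: "inner (D v) w = inner v (D w)" for v w
    using sa by (simp flip: Re_cinner)
  obtain B mu where B: "orthonormal_eigenbasis UNIV D mu B"
    using symmetric_operator_eigenbasis [OF lin subspace_UNIV] sym by auto
  have Db: "D b = mu b *\<^sub>R b" "b \<noteq> 0" "inner b b = 1" if "b \<in> B" for b
    using B that by (auto simp: orthonormal_eigenbasis_def dot_square_norm)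
  \<comment> \<open>The matrix of \<open>D\<close> on the span of \<open>x\<close> and \<open>y\<close>; \<open>t\<close> and \<open>d\<close> are its trace and determinant.\<close>
  have D_xy: "D (p *\<^sub>C x - q *\<^sub>C y)
      = (p * X - q * cnj z) *\<^sub>C x - (p * z - q * Y) *\<^sub>C y" for p q
    by (simp add: D_def rank_one_def cinner_diff_left cinner_scaleC_left cinner_self X_def Y_def z_def
        flip: cinner_commute)
  have cub: "D (D (D v)) = t *\<^sub>R D (D v) - d *\<^sub>R D v" for v
  proof -
    obtain p q where pq: "D v = p *\<^sub>C x - q *\<^sub>C y" by (simp add: D_def rank_one_def)
    have d: "complex_of_real d = z * cnj z - X * Y"
      unfolding d_def using complex_norm_square [of z] by simp
    have "t *\<^sub>R D (D v) - d *\<^sub>R D v =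
        (t * (p * X - q * cnj z) - d * p) *\<^sub>C x - (t * (p * z - q * Y) - d * q) *\<^sub>C y"
      unfolding pq D_xy
      by (simp add: scaleR_eq_scaleC complex_vs.scale_right_diff_distrib
          complex_vs.scale_left_diff_distrib scaleC_scaleC right_diff_distrib)
    also have "\<dots> = D (D (D v))"
      unfolding pq D_xy by (simp add: t_def d algebra_simps)
    finally show ?thesis by simp
  qed
  have cmu: "mu b ^ 3 = t * (mu b)\<^sup>2 - d * mu b" if "b \<in> B" for b
  proof -
    have "(mu b ^ 3) *\<^sub>R b = (t * (mu b)\<^sup>2 - d * mu b) *\<^sub>R b"
      using cub [of b] Db(1) [OF that]
      by (simp add: linear_scale [OF lin] power3_eq_cube power2_eq_square scaleR_diff_left mult.assoc)
    then show ?thesis using Db(2) [OF that] by simp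
  qed
  have Xi: "inner x x = X" "inner y y = Y" by (simp_all add: X_def Y_def dot_square_norm)
  have "cmod z \<le> norm x * norm y" unfolding z_def by (rule cinner_Cauchy_Schwarz)
  then have "(cmod z)\<^sup>2 \<le> (norm x * norm y)\<^sup>2" by (intro power_mono) auto
  then have d0: "d \<le> 0" by (simp add: d_def X_def Y_def power_mult_distrib)
  have sum1: "(\<Sum>b\<in>B. mu b) = 2 * t"
  proof -
    have "mu b = inner (cinner b x *\<^sub>C x) b - inner (cinner b y *\<^sub>C y) b" if "b \<in> B" for b
    proof -
      have "mu b = inner (D b) b" using Db [OF that] by simp
      then show ?thesis by (simp add: D_def rank_one_def inner_diff_left)
    qed
    then show ?thesis
      by (simp add: sum_subtractf eigenbasis_trace_rank_one [OF B] t_def Xi)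
  qed
  have sum2: "(\<Sum>b\<in>B. (mu b)\<^sup>2) = 2 * (t\<^sup>2 - 2 * d)"
  proof -
    have "(mu b)\<^sup>2 = inner (cinner b x *\<^sub>C D x) b - inner (cinner b y *\<^sub>C D y) b" if "b \<in> B" for b
    proof -
      have "(mu b)\<^sup>2 = inner (D (D b)) b"
        using Db [OF that] by (simp add: linear_scale [OF lin] power2_eq_square)
      also have "D (D b) = cinner b x *\<^sub>C D x - cinner b y *\<^sub>C D y"
        by (subst (2) D_def) (simp add: rank_one_def linear_diff [OF lin] scale)
      finally show ?thesis by (simp add: inner_diff_left)
    qed
    then have "(\<Sum>b\<in>B. (mu b)\<^sup>2) = 2 * inner x (D x) - 2 * inner y (D y)"
      by (simp add: sum_subtractf eigenbasis_trace_rank_one [OF B])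
    moreover have "inner x (D x) = X * X - (cmod z)\<^sup>2"
      using cinner_self [of x] cmod_power2 [of "cinner x y"]
      by (simp add: D_def rank_one_def cinner_scaleC_right cinner_diff_right X_def
          power2_eq_square z_def flip: Re_cinner)
    moreover have "inner y (D y) = (cmod z)\<^sup>2 - Y * Y"
      using cinner_self [of y] cinner_commute [of y x] cmod_power2 [of "cinner x y"]
      by (simp add: D_def rank_one_def cinner_scaleC_right cinner_diff_right Y_def
          power2_eq_square z_def flip: Re_cinner)
    ultimately show ?thesis by (simp add: t_def d_def power2_eq_square algebra_simps)
  qed
  define N where "N = sqrt (t\<^sup>2 - 4 * d)"
  have "t\<^sup>2 - 4 * d \<ge> 0" using d0 zero_le_power2 [of t] by linarith
  then have N2: "N\<^sup>2 = t\<^sup>2 - 4 * d" by (simp add: N_def)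
  have nn: "2 * nuclear_norm D = (\<Sum>b\<in>B. \<bar>mu b\<bar>)"
    using nuclear_norm_selfadjoint [OF add scale sa B] .
  have "N * (2 * nuclear_norm D) = (\<Sum>b\<in>B. 2 * (mu b)\<^sup>2 - t * mu b)"
    unfolding nn sum_distrib_left
    by (rule sum.cong) (simp_all add: N_def cubic_root_abs cmu d0)
  also have "\<dots> = 2 * N\<^sup>2"
    unfolding sum_subtractf N2 sum_distrib_left [symmetric] sum1 sum2
    by (simp add: power2_eq_square algebra_simps)
  finally have eq: "N * nuclear_norm D = N * N" by (simp add: power2_eq_square)
  have "nuclear_norm D = N"
  \<comment> \<open>If \<open>N = 0\<close>, then \<open>t = d = 0\<close> and the second power sum is \<open>0\<close>, so all eigenvalues vanish.\<close>
  proof (cases "N = 0")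
    case True
    then have "t\<^sup>2 - 4 * d = 0" using N2 by simp
    then have "t\<^sup>2 - 2 * d = 0" using d0 zero_le_power2 [of t] by linarith
    then have "(\<Sum>b\<in>B. (mu b)\<^sup>2) = 0" using sum2 by simp
    moreover have "finite B" using B by (simp add: orthonormal_eigenbasis_def)
    ultimately have "mu b = 0" if "b \<in> B" for b
      using that by (simp add: sum_nonneg_eq_0_iff)
    then show ?thesis using nn True by simp
  qed (use eq in simp)
  moreover have "t\<^sup>2 - 4 * d = (X + Y)\<^sup>2 - 4 * (cmod z)\<^sup>2"
    by (simp add: t_def d_def power2_eq_square algebra_simps)
  ultimately show ?thesis
    by (simp add: nuclear_dist_def N_def X_def Y_def z_def flip: D_def)
qed

lemma nuclear_dist_phase:
  assumes "cmod z = 1"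
  shows "nuclear_dist (rank_one x) (rank_one (z *\<^sub>C x)) = 0"
  using assms
  by (simp add: nuclear_dist_rank_one norm_scaleC_unit cinner_scaleC_right norm_mult cinner_self
      norm_power)

text \<open>
  The geometric meaning of the nuclear distance: with \<open>u = x + y\<close> and \<open>v = x - y\<close> it is \<open>\<parallel>u\<parallel>\<close>
  times the norm of the component \<open>w\<close> of \<open>v\<close> that is orthogonal to \<open>\<i> u\<close>. The direction \<open>\<i> u\<close> is
  the one that intensities do not see.
\<close>

lemma nuclear_dist_orthogonal_component:
  fixes x y :: "'a::complex_euclidean_space"
  obtains w s where "x - y = w + s *\<^sub>R \<i> *\<^sub>C (x + y)" "inner w (\<i> *\<^sub>C (x + y)) = 0"
    "nuclear_dist (rank_one x) (rank_one y) = norm (x + y) * norm w"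
proof -
  define u v where "u = x + y" and "v = x - y"
  define e where "e = \<i> *\<^sub>C u"
  \<comment> \<open>For \<open>u = 0\<close> the quotient is \<open>0\<close>, and then \<open>w = v\<close>.\<close>
  define s where "s = inner v e / (norm u)\<^sup>2"
  define w where "w = v - s *\<^sub>R e"
  have ee: "inner e e = (norm u)\<^sup>2" by (simp add: e_def dot_square_norm norm_scaleC_unit)
  have we: "inner w e = 0"
  proof (cases "u = 0")
    case False
    then show ?thesis by (simp add: w_def inner_diff_left ee s_def)
  qed (simp add: e_def)
  have "(norm u * norm w)\<^sup>2 = (norm u)\<^sup>2 * inner w v"
    using we by (simp add: power_mult_distrib dot_square_norm [symmetric] w_def inner_diff_right)
  also have "\<dots> = (norm u)\<^sup>2 * (norm v)\<^sup>2 - (inner v e)\<^sup>2"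
    by (auto simp: w_def inner_diff_left dot_square_norm s_def power2_eq_square algebra_simps
        inner_commute e_def)
  also have "\<dots> = ((norm x)\<^sup>2 + (norm y)\<^sup>2)\<^sup>2 - 4 * (cmod (cinner x y))\<^sup>2"
  proof -
    have uv: "(norm u)\<^sup>2 = (norm x)\<^sup>2 + (norm y)\<^sup>2 + 2 * Re (cinner x y)"
        "(norm v)\<^sup>2 = (norm x)\<^sup>2 + (norm y)\<^sup>2 - 2 * Re (cinner x y)"
      by (simp_all add: u_def v_def Re_cinner inner_add_left inner_add_right inner_diff_left
          inner_diff_right inner_commute flip: dot_square_norm)
    have "inner v e = 2 * Im (cinner x y)"
      using cinner_commute [of y x]
      by (simp add: e_def u_def v_def cinner_add_right cinner_diff_left cinner_self flip: Im_cinner)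
    then show ?thesis
      unfolding uv cmod_power2 by (simp add: power2_eq_square algebra_simps)
  qed
  finally have "nuclear_dist (rank_one x) (rank_one y) = norm u * norm w"
    unfolding nuclear_dist_rank_one by (metis abs_of_nonneg mult_nonneg_nonneg norm_ge_zero real_sqrt_abs)
  then show thesis
    using that [of w s] we by (simp add: w_def e_def u_def v_def)
qed


section \<open>Polarized intensities\<close>

text \<open>
  The symmetric real-bilinear map whose quadratic form is the intensity. Its component \<open>k\<close> is the
  bilinear form of \<open>\<Phi>\<^sub>k\<close> on the realification.
\<close>

definition polarized_intensity ::
  "('m::finite \<Rightarrow> 'a::complex_euclidean_space) \<Rightarrow> 'a \<Rightarrow> 'a \<Rightarrow> real ^ 'm" where
  "polarized_intensity f u w = (\<chi> k. Re (cinner u (f k) * cnj (cinner w (f k))))"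

text \<open>
  The identity \<open>\<beta>(x, x) - \<beta>(y, y) = \<beta>(x + y, x - y)\<close> for a symmetric bilinear \<open>\<beta>\<close>.
\<close>

lemma intensity_diff:
  "intensity f x - intensity f y = polarized_intensity f (x + y) (x - y)"
proof -
  have "(cmod a)\<^sup>2 - (cmod b)\<^sup>2 = Re ((a + b) * cnj (a - b))" for a b
    unfolding cmod_power2 by (simp add: power2_eq_square algebra_simps)
  then show ?thesis
    by (simp add: vec_eq_iff intensity_def polarized_intensity_def cinner_add_left cinner_diff_left)
qed

lemma linear_polarized_intensity: "linear (polarized_intensity f u)"
  by (rule linearI)
    (simp_all add: polarized_intensity_def vec_eq_iff cinner_add_left linear_scale [OF linear_cinner]
      algebra_simps)

lemma polarized_intensity_scale:
  "polarized_intensity f (r *\<^sub>R u) (s *\<^sub>R w) = (r * s) *\<^sub>R polarized_intensity f u w"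
  by (simp add: polarized_intensity_def vec_eq_iff linear_scale [OF linear_cinner])

lemma polarized_intensity_i_self: "polarized_intensity f u (\<i> *\<^sub>C u) = 0"
  by (simp add: polarized_intensity_def vec_eq_iff cinner_scaleC_left algebra_simps)

lemma continuous_on_cinner_left:
  "continuous_on S (\<lambda>p. cinner (g p) (w :: 'a::complex_euclidean_space))" if "continuous_on S g"
  by (rule bounded_linear.continuous_on [OF _ that])
    (simp add: linear_cinner flip: linear_conv_bounded_linear)

lemma continuous_on_norm_polarized_intensity:
  "continuous_on S (\<lambda>p. norm (polarized_intensity f (fst p) (snd p)))"
  unfolding polarized_intensity_def
  by (intro continuous_intros continuous_on_vec_lambda continuous_on_cinner_left)

lemma continuous_on_scaleC:
  "continuous_on S (\<lambda>p. a *\<^sub>C (g p :: 'a::complex_euclidean_space))" if "continuous_on S g"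
  by (rule bounded_linear.continuous_on [OF _ that])
    (simp add: linear_scaleC flip: linear_conv_bounded_linear)

lemma polarized_intensity_attains_max:
  fixes f :: "'m::finite \<Rightarrow> 'a::complex_euclidean_space"
  shows "\<exists>u w. norm u = 1 \<and> norm w = 1 \<and>
    (\<forall>u' w'. norm u' = 1 \<longrightarrow> norm w' = 1 \<longrightarrow>
       norm (polarized_intensity f u' w') \<le> norm (polarized_intensity f u w))"
proof -
  let ?K = "sphere 0 1 \<times> sphere 0 1 :: ('a \<times> 'a) set"
  have "\<exists>p\<in>?K. \<forall>q\<in>?K. norm (polarized_intensity f (fst q) (snd q))
      \<le> norm (polarized_intensity f (fst p) (snd p))"
  proof (rule continuous_attains_sup)
    show "compact ?K" by (intro compact_Times compact_sphere)
    have "((SOME b. b \<in> Basis), (SOME b. b \<in> Basis)) \<in> ?K"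
      using norm_Basis [OF SOME_Basis [where 'a = 'a]] by simp
    then show "?K \<noteq> {}" by blast
  qed (rule continuous_on_norm_polarized_intensity)
  then obtain p where p: "p \<in> ?K" "\<forall>q\<in>?K. norm (polarized_intensity f (fst q) (snd q))
      \<le> norm (polarized_intensity f (fst p) (snd p))" by (elim bexE)
  show ?thesis
  proof (intro exI conjI allI impI)
    fix u w :: 'a
    assume "norm u = 1" "norm w = 1"
    then show "norm (polarized_intensity f u w) \<le> norm (polarized_intensity f (fst p) (snd p))"
      using bspec [OF p(2), of "(u, w)"] by simp
  qed (use p(1) in auto)
qed

text \<open>
  The constraint is closed in the pair \<open>(u, w)\<close>, so the minimum is attained jointly in \<open>u\<close> and
  \<open>w\<close>. It is consistent because every unit vector \<open>u\<close> is orthogonal to \<open>\<i> u\<close>, so \<open>w = u\<close> is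
  admissible.
\<close>

lemma polarized_intensity_attains_min:
  fixes f :: "'m::finite \<Rightarrow> 'a::complex_euclidean_space"
  shows "\<exists>u w. norm u = 1 \<and> norm w = 1 \<and> inner w (\<i> *\<^sub>C u) = 0 \<and>
    (\<forall>u' w'. norm u' = 1 \<longrightarrow> norm w' = 1 \<longrightarrow> inner w' (\<i> *\<^sub>C u') = 0 \<longrightarrow>
       norm (polarized_intensity f u w) \<le> norm (polarized_intensity f u' w'))"
proof -
  let ?O = "{p :: 'a \<times> 'a. inner (snd p) (\<i> *\<^sub>C fst p) = 0}"
  let ?K = "sphere 0 1 \<times> sphere 0 1 \<inter> ?O"
  have "\<exists>p\<in>?K. \<forall>q\<in>?K. norm (polarized_intensity f (fst p) (snd p))
      \<le> norm (polarized_intensity f (fst q) (snd q))"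
  proof (rule continuous_attains_inf)
    have "closed ?O"
      by (intro closed_Collect_eq continuous_intros continuous_on_scaleC)
    then show "compact ?K" by (intro compact_Int_closed compact_Times compact_sphere)
    have "((SOME b. b \<in> Basis), (SOME b. b \<in> Basis)) \<in> ?K"
      using norm_Basis [OF SOME_Basis [where 'a = 'a]] by (simp add: inner_i_self)
    then show "?K \<noteq> {}" by blast
  qed (rule continuous_on_norm_polarized_intensity)
  then obtain p where p: "p \<in> ?K" "\<forall>q\<in>?K. norm (polarized_intensity f (fst p) (snd p))
      \<le> norm (polarized_intensity f (fst q) (snd q))" by (elim bexE)
  show ?thesis
  proof (intro exI conjI allI impI)
    fix u w :: 'a
    assume "norm u = 1" "norm w = 1" "inner w (\<i> *\<^sub>C u) = 0"
    then show "norm (polarized_intensity f (fst p) (snd p)) \<le> norm (polarized_intensity f u w)"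
      using bspec [OF p(2), of "(u, w)"] by simp
  qed (use p(1) in auto)
qed


section \<open>The operator \<open>R(\<xi>)\<close> on the realification\<close>

lemma linear_realify:
  assumes "conjugation c"
  shows "linear (realify c)"
proof (rule linearI)
  have c: "c (x + y) = c x + c y" "c (r *\<^sub>R x) = r *\<^sub>R c x" for x y r
    using assms by (simp_all add: conjugation_def scaleR_eq_scaleC)
  show "realify c (x + y) = realify c x + realify c y" for x y
    by (simp add: realify_def c scaleC_add_right complex_vs.scale_right_diff_distrib)
  show "realify c (r *\<^sub>R x) = r *\<^sub>R realify c x" for r x
    by (simp add: realify_def c scaleR_add_right flip: linear_scale [OF linear_scaleC] scaleR_diff_right)
qed

lemma inner_realify_eq_inner: "conjugation c \<Longrightarrow> inner (realify c v) (realify c w) = inner v w"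
  by (simp add: inner_realify Re_cinner)

lemma norm_realify: "conjugation c \<Longrightarrow> norm (realify c v) = norm v"
  by (simp add: norm_eq_sqrt_inner inner_realify_eq_inner)

lemma subspace_H_R: "conjugation c \<Longrightarrow> subspace (H_R c)"
  unfolding H_R_def by (rule linear_subspace_image [OF linear_realify subspace_UNIV])

lemma dim_H_R:
  fixes c :: "'a::complex_euclidean_space \<Rightarrow> 'a"
  assumes "conjugation c"
  shows "dim (H_R c) = 2 * cdim (UNIV :: 'a set)"
proof -
  have "inj (realify c)"
    using linear_injective_0 [OF linear_realify [OF assms]] norm_realify [OF assms]
    by (metis norm_eq_zero)
  then have "dim (H_R c) = dim (UNIV :: 'a set)"
    unfolding H_R_def using linear_realify [OF assms] by (intro dim_image_eq) auto
  also have "\<dots> = 2 * cdim (UNIV :: 'a set)"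
    by (rule dim_eq_twice_cdim) simp
  finally show ?thesis .
qed

lemma linear_J: "linear (J :: 'a::complex_euclidean_space \<times> 'a \<Rightarrow> _)"
  by (rule linearI) (simp_all add: J_def)

lemma linear_Phi: "linear (Phi c f k)"
  by (rule linearI)
    (simp_all add: Phi_def real_rank_one_def adjoint_J inner_add_left linear_add [OF linear_J]
      linear_diff [OF linear_J] linear_neg [OF linear_J] linear_scale [OF linear_J] algebra_simps)

text \<open>
  On the realification \<open>\<Phi>\<^sub>k\<close> is the complex rank-one operator \<open>f\<^sub>k f\<^sub>k\<^sup>*\<close>: its two summands produce
  the real and the imaginary part of the coefficient \<open>\<langle>w, f\<^sub>k\<rangle>\<close>.
\<close>

lemma Phi_realify:
  assumes c: "conjugation c"
  shows "Phi c f k (realify c w) = realify c (cinner w (f k) *\<^sub>C f k)"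
proof -
  let ?j = "realify c"
  have "Phi c f k (?j w) = Re (cinner w (f k)) *\<^sub>R ?j (f k) + Im (cinner w (f k)) *\<^sub>R ?j (\<i> *\<^sub>C f k)"
    by (simp add: Phi_def real_rank_one_def adjoint_J J_realify [OF c] inner_realify [OF c]
        cinner_scaleC_left linear_scale [OF linear_J] linear_neg [OF linear_J])
  also have "\<dots> = ?j (Re (cinner w (f k)) *\<^sub>R f k + Im (cinner w (f k)) *\<^sub>R \<i> *\<^sub>C f k)"
    using linear_realify [OF c] by (simp add: linear_add linear_scale)
  also have "Re a *\<^sub>R x + Im a *\<^sub>R \<i> *\<^sub>C x = a *\<^sub>C x" for a and x :: 'a
    by (simp add: scaleR_eq_scaleC scaleC_scaleC mult.commute flip: scaleC_add_left complex_eq)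
  finally show ?thesis .
qed

lemma linear_R_op: "linear (R_op c f \<xi>)"
  unfolding R_op_def
proof (intro linear_compose_sum ballI)
  fix k
  have "linear (Phi c f k \<circ> real_rank_one \<xi> \<circ> Phi c f k)"
    by (intro linear_compose linear_Phi linearI)
      (simp_all add: real_rank_one_def inner_add_left scaleR_add_left)
  then show "linear (\<lambda>\<eta>. Phi c f k (real_rank_one \<xi> (Phi c f k \<eta>)))"
    by (simp add: o_def)
qed

lemma R_op_realify:
  assumes c: "conjugation c"
  shows "R_op c f (realify c u) (realify c w)
    = realify c (\<Sum>k\<in>UNIV. polarized_intensity f u w $ k *\<^sub>R cinner u (f k) *\<^sub>C f k)"
proof -
  have "Phi c f k (real_rank_one (realify c u) (Phi c f k (realify c w)))
      = realify c (polarized_intensity f u w $ k *\<^sub>R cinner u (f k) *\<^sub>C f k)" for k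
  proof -
    have "inner (Phi c f k (realify c w)) (realify c u) = polarized_intensity f u w $ k"
      by (simp add: Phi_realify [OF c] inner_realify [OF c] cinner_scaleC_left
          polarized_intensity_def cinner_commute [of "f k" u] algebra_simps)
    then show ?thesis
      by (simp add: real_rank_one_def linear_scale [OF linear_Phi] Phi_realify [OF c]
          linear_scale [OF linear_realify [OF c]])
  qed
  then show ?thesis
    by (simp add: R_op_def linear_sum [OF linear_realify [OF c]])
qed

text \<open>
  Up to the isometry \<open>realify c\<close>, the operator \<open>R(\<xi>)\<close> with \<open>\<xi> = realify c u\<close> is \<open>T\<^sup>* T\<close> for the
  linear map \<open>T = polarized_intensity f u\<close>. Its symmetry and semidefiniteness, its norm and its
  eigenvalues are all read off from this identity.
\<close>

lemma inner_R_op: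
  assumes c: "conjugation c"
  shows "inner (R_op c f (realify c u) (realify c w)) (realify c z)
    = inner (polarized_intensity f u w) (polarized_intensity f u z)"
proof -
  have "inner (cinner u (f k) *\<^sub>C f k) z = polarized_intensity f u z $ k" for k
    by (simp add: polarized_intensity_def cinner_scaleC_left cinner_commute [of "f k" z] flip: Re_cinner)
  then show ?thesis
    by (simp add: R_op_realify [OF c] inner_realify_eq_inner [OF c] inner_sum_left inner_vec_def)
qed

lemma R_op_J:
  assumes c: "conjugation c"
  shows "R_op c f (realify c u) (realify c (\<i> *\<^sub>C u)) = 0"
  by (simp add: R_op_realify [OF c] polarized_intensity_i_self linear_0 [OF linear_realify [OF c]])

text \<open>
  This is \<open>\<parallel>T\<^sup>* T w\<parallel> \<le> \<parallel>T\<parallel>\<^sup>2 \<parallel>w\<parallel>\<close>, obtained by testing \<open>T\<^sup>* T w\<close> against itself.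
\<close>

lemma norm_R_op_le:
  assumes c: "conjugation c" and bound: "\<And>w. norm (polarized_intensity f u w) \<le> m * norm w"
  shows "norm (R_op c f (realify c u) (realify c w)) \<le> m\<^sup>2 * norm w"
proof -
  obtain z where z: "R_op c f (realify c u) (realify c w) = realify c z"
    using R_op_realify [OF c] by blast
  have "(norm z)\<^sup>2 = inner (polarized_intensity f u w) (polarized_intensity f u z)"
    using inner_R_op [OF c, of f u w z]
    by (simp add: z norm_realify [OF c] dot_square_norm)
  also have "\<dots> \<le> norm (polarized_intensity f u w) * norm (polarized_intensity f u z)"
    by (rule norm_cauchy_schwarz)
  also have "\<dots> \<le> (m * norm w) * (m * norm z)"
    using bound order_trans [OF norm_ge_zero bound] by (intro mult_mono) auto
  finally have "norm z * norm z \<le> m\<^sup>2 * norm w * norm z"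
    by (simp add: power2_eq_square mult_ac)
  then have "norm z \<le> m\<^sup>2 * norm w"
    by (cases "norm z = 0") (auto simp: mult_le_cancel_right)
  then show ?thesis by (simp add: z norm_realify [OF c])
qed

lemma norm_R_le:
  assumes c: "conjugation c" and bound: "\<And>w. norm (polarized_intensity f u w) \<le> m * norm w"
  shows "norm_R c f (realify c u) \<le> m\<^sup>2"
  unfolding norm_R_def onorm_on_def
proof (rule cSUP_least)
  show "H_R c \<noteq> {}" by (simp add: H_R_def)
  fix x assume "x \<in> H_R c"
  then obtain w where "x = realify c w" by (auto simp: H_R_def)
  then show "norm (R_op c f (realify c u) x) / norm x \<le> m\<^sup>2"
    using norm_R_op_le [OF assms] by (cases "w = 0") (simp_all add: norm_realify [OF c] divide_le_eq)
qed

lemma norm_R_ge: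
  assumes c: "conjugation c" and bound: "\<And>w. norm (polarized_intensity f u w) \<le> m * norm w"
    and w: "norm w = 1"
  shows "(norm (polarized_intensity f u w))\<^sup>2 \<le> norm_R c f (realify c u)"
proof -
  let ?R = "R_op c f (realify c u)"
  have "(norm (polarized_intensity f u w))\<^sup>2 = inner (?R (realify c w)) (realify c w)"
    by (simp add: inner_R_op [OF c] dot_square_norm)
  also have "\<dots> \<le> norm (?R (realify c w)) * norm (realify c w)" by (rule norm_cauchy_schwarz)
  also have "\<dots> = norm (?R (realify c w)) / norm (realify c w)" by (simp add: norm_realify [OF c] w)
  also have "\<dots> \<le> norm_R c f (realify c u)"
    unfolding norm_R_def onorm_on_def
  proof (rule cSUP_upper)
    show "realify c w \<in> H_R c" by (simp add: H_R_def)
    show "bdd_above ((\<lambda>x. norm (?R x) / norm x) ` H_R c)"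
    proof (rule bdd_aboveI2)
      fix x assume "x \<in> H_R c"
      then obtain w where "x = realify c w" by (auto simp: H_R_def)
      then show "norm (?R x) / norm x \<le> m\<^sup>2"
        using norm_R_op_le [OF c bound] by (cases "w = 0") (simp_all add: norm_realify [OF c] divide_le_eq)
    qed
  qed
  finally show ?thesis .
qed

text \<open>
  The two parts say that \<open>a\<^sub>2\<^sub>n\<^sub>-\<^sub>1(R(\<xi>))\<close>, for \<open>\<xi> = realify c u\<close>, is the minimum of the quadratic
  form of \<open>R(\<xi>)\<close> over the unit vectors orthogonal to \<open>J \<xi>\<close>. Since \<open>J \<xi>\<close> is a null vector of
  \<open>R(\<xi>)\<close>, an eigenbasis of its orthogonal complement carries all eigenvalues but one \<open>0\<close>.
\<close>

lemma next_smallest_eigenvalue_R_realify: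
  fixes c :: "'a::complex_euclidean_space \<Rightarrow> 'a"
  assumes c: "conjugation c" and u: "norm u = 1"
  shows "\<exists>w. norm w = 1 \<and> inner w (\<i> *\<^sub>C u) = 0 \<and>
      next_smallest_eigenvalue_R c f (realify c u) = (norm (polarized_intensity f u w))\<^sup>2"
    and "norm w = 1 \<Longrightarrow> inner w (\<i> *\<^sub>C u) = 0 \<Longrightarrow>
      next_smallest_eigenvalue_R c f (realify c u) \<le> (norm (polarized_intensity f u w))\<^sup>2"
proof -
  let ?j = "realify c"
  define T where "T = R_op c f (?j u)"
  define x where "x = ?j (\<i> *\<^sub>C u)"
  define W where "W = {v \<in> H_R c. inner v x = 0}"
  have lin: "linear T" by (simp add: T_def linear_R_op)
  have x: "x \<in> H_R c" "norm x = 1" "T x = 0"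
    by (simp_all add: x_def H_R_def T_def R_op_J [OF c] norm_realify [OF c] norm_scaleC_unit u)
  have inv: "T v \<in> H_R c" if "v \<in> H_R c" for v
    using that R_op_realify [OF c] by (auto simp: H_R_def T_def)
  have sym: "inner (T v) w = inner v (T w)" if vw: "v \<in> H_R c" "w \<in> H_R c" for v w
  proof -
    obtain v' w' where "v = realify c v'" "w = realify c w'"
      using vw by (auto simp: H_R_def)
    then have "inner (T v) w = inner (T w) v"
      using inner_commute [of "polarized_intensity f u v'" "polarized_intensity f u w'"]
      by (simp add: T_def inner_R_op [OF c])
    then show ?thesis by (simp only: inner_commute)
  qed
  have W: "subspace W"
    using subspace_H_R [OF c] by (auto simp: W_def subspace_def inner_add_left)
  have "T v \<in> W" if "v \<in> W" for v
    using that inv sym [of v x] x by (auto simp: W_def)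
  moreover have "inner (T v) w = inner v (T w)" if "v \<in> W" "w \<in> W" for v w
    using that sym by (auto simp: W_def)
  ultimately obtain B lam where B: "orthonormal_eigenbasis W T lam B"
    using symmetric_operator_eigenbasis [OF lin W] by blast
  have fin: "finite B" and Bs: "B \<subseteq> W" and eig: "\<And>b. b \<in> B \<Longrightarrow> norm b = 1 \<and> T b = lam b *\<^sub>R b"
    using B span_superset [of B] by (auto simp: orthonormal_eigenbasis_def)
  have lam: "\<exists>w. norm w = 1 \<and> inner w (\<i> *\<^sub>C u) = 0 \<and> lam b = (norm (polarized_intensity f u w))\<^sup>2"
    if "b \<in> B" for b
  proof -
    obtain w where w: "b = ?j w" using Bs \<open>b \<in> B\<close> by (auto simp: W_def H_R_def)
    have "lam b = inner (T b) b" using eig [OF that] by (simp add: dot_square_norm)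
    then have "lam b = (norm (polarized_intensity f u w))\<^sup>2"
      by (simp add: w T_def inner_R_op [OF c] dot_square_norm)
    moreover have "norm w = 1" "inner w (\<i> *\<^sub>C u) = 0"
      using eig [OF that] that Bs
      by (auto simp: w W_def x_def norm_realify [OF c] inner_realify_eq_inner [OF c])
    ultimately show ?thesis by blast
  qed
  have "?j u \<in> W"
    by (simp add: W_def H_R_def x_def inner_realify_eq_inner [OF c] inner_i_self)
  moreover have "?j u \<noteq> 0" using norm_realify [OF c, of u] u by auto
  ultimately have ne: "B \<noteq> {}" using B by (auto simp: orthonormal_eigenbasis_def)
  have "cdim (UNIV :: 'a set) \<noteq> 0"
    using dim_eq_twice_cdim [of "UNIV :: 'a set"] DIM_positive [where 'a = 'a] by (intro notI) simp
  then have "nth_eigenvalue (H_R c) T (dim (H_R c) - 1) = Min (lam ` B)"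
  proof (intro next_smallest_eigenvalue_eq_Min [OF lin subspace_H_R [OF c] x])
    show "orthonormal_eigenbasis {v \<in> H_R c. inner v x = 0} T lam B" using B by (simp add: W_def)
    show "lam b \<ge> 0" if "b \<in> B" for b using lam [OF that] by auto
  qed (simp add: dim_H_R [OF c])
  then have nx: "next_smallest_eigenvalue_R c f (?j u) = Min (lam ` B)"
    by (simp add: next_smallest_eigenvalue_R_def T_def dim_H_R [OF c])
  have "Min (lam ` B) \<in> lam ` B" using fin ne by simp
  then show "\<exists>w. norm w = 1 \<and> inner w (\<i> *\<^sub>C u) = 0 \<and>
      next_smallest_eigenvalue_R c f (?j u) = (norm (polarized_intensity f u w))\<^sup>2"
    using lam unfolding nx by (elim imageE) simp
  assume w: "norm w = 1" "inner w (\<i> *\<^sub>C u) = 0"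
  then have "?j w \<in> W"
    by (simp add: W_def H_R_def x_def inner_realify_eq_inner [OF c])
  then show "next_smallest_eigenvalue_R c f (?j u) \<le> (norm (polarized_intensity f u w))\<^sup>2"
    using eigenbasis_Min_le [OF B lin, of "?j w"] w
    by (simp add: nx T_def inner_R_op [OF c] norm_realify [OF c] dot_square_norm)
qed


section \<open>The Lipschitz bounds\<close>

lemma unit_sphere_R_eq: "conjugation c \<Longrightarrow> unit_sphere_R c = realify c ` sphere 0 1"
  by (auto simp: unit_sphere_R_def H_R_def norm_realify)

lemma polarized_intensity_normalize:
  assumes "u \<noteq> 0" "w \<noteq> 0"
  shows "norm (polarized_intensity f u w)
    = norm (polarized_intensity f (u /\<^sub>R norm u) (w /\<^sub>R norm w)) * (norm u * norm w)"
proof -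
  have "norm u * norm w * (inverse (norm u) * inverse (norm w)) = 1"
    using assms by (simp add: field_simps)
  then show ?thesis by (simp add: polarized_intensity_scale mult_ac)
qed

lemma polarized_intensity_zero [simp]:
  "polarized_intensity f 0 w = 0" "polarized_intensity f u 0 = 0"
  by (simp_all add: polarized_intensity_def vec_eq_iff linear_0 [OF linear_cinner])

text \<open>
  The norm of \<open>R(\<xi>)\<close> is the maximum over unit vectors \<open>w\<close> of \<open>\<parallel>polarized_intensity f u w\<parallel>\<^sup>2\<close>, so a
  joint maximiser of \<open>\<parallel>polarized_intensity f u w\<parallel>\<close> over two unit vectors gives the maximising \<open>\<xi>\<close>,
  and \<open>B0 c f\<close> is the norm of the bilinear map. Taking both maxima at once avoids a continuity
  argument for \<open>\<xi> \<mapsto> \<parallel>R(\<xi>)\<parallel>\<close>.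
\<close>

lemma B0_attained:
  assumes c: "conjugation c"
  shows "\<exists>\<xi>. is_arg_max (norm_R c f) (\<lambda>\<xi>. \<xi> \<in> unit_sphere_R c) \<xi>"
    and "norm (polarized_intensity f u w) \<le> B0 c f * (norm u * norm w)"
proof -
  obtain u0 w0 where 0: "norm u0 = 1" "norm w0 = 1"
    and max: "\<forall>u w. norm u = 1 \<longrightarrow> norm w = 1 \<longrightarrow>
       norm (polarized_intensity f u w) \<le> norm (polarized_intensity f u0 w0)"
    using polarized_intensity_attains_max [of f] by (elim exE conjE)
  define m where "m = norm (polarized_intensity f u0 w0)"
  have bound: "norm (polarized_intensity f u w) \<le> m * (norm u * norm w)" for u w
  proof (cases "u = 0 \<or> w = 0")
    case False
    then have "norm (polarized_intensity f (u /\<^sub>R norm u) (w /\<^sub>R norm w)) \<le> m"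
      unfolding m_def by (intro max [rule_format]) auto
    then show ?thesis
      using False polarized_intensity_normalize [of u w f] by (simp add: mult_right_mono)
  qed (auto simp: m_def)
  have le: "norm_R c f (realify c u) \<le> m\<^sup>2" if "norm u = 1" for u
    using bound [of u] that by (intro norm_R_le [OF c]) simp
  have ge: "m\<^sup>2 \<le> norm_R c f (realify c u0)"
    unfolding m_def using bound [of u0] 0 by (intro norm_R_ge [OF c, of f u0 m]) simp_all
  have u0: "realify c u0 \<in> unit_sphere_R c" using 0 by (simp add: unit_sphere_R_eq [OF c])
  have le': "norm_R c f \<xi> \<le> norm_R c f (realify c u0)" if "\<xi> \<in> unit_sphere_R c" for \<xi>
    using that le ge by (force simp: unit_sphere_R_eq [OF c])
  then show "\<exists>\<xi>. is_arg_max (norm_R c f) (\<lambda>\<xi>. \<xi> \<in> unit_sphere_R c) \<xi>"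
    using u0 by (intro exI [of _ "realify c u0"]) (simp add: is_arg_max_def not_less)
  have "(SUP \<xi>\<in>unit_sphere_R c. norm_R c f \<xi>) = norm_R c f (realify c u0)"
    using u0 le' by (intro cSup_eq_maximum) auto
  also have "\<dots> = m\<^sup>2" using le [OF 0(1)] ge by (rule antisym)
  finally have "B0 c f = m" by (simp add: B0_def m_def)
  then show "norm (polarized_intensity f u w) \<le> B0 c f * (norm u * norm w)"
    using bound by simp
qed

text \<open>
  The counterpart for minima, with \<open>w\<close> restricted to the orthogonal complement of \<open>\<i> u\<close>. That
  \<open>A0 c f\<close> is attained at some pair, the last claim, is what makes it positive later.
\<close>

lemma A0_attained:
  assumes c: "conjugation c"
  shows "\<exists>\<xi>. is_arg_min (next_smallest_eigenvalue_R c f) (\<lambda>\<xi>. \<xi> \<in> unit_sphere_R c) \<xi>"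
    and "inner w (\<i> *\<^sub>C u) = 0 \<Longrightarrow> A0 c f * (norm u * norm w) \<le> norm (polarized_intensity f u w)"
    and "\<exists>u w. norm u = 1 \<and> norm w = 1 \<and> inner w (\<i> *\<^sub>C u) = 0 \<and>
      A0 c f = norm (polarized_intensity f u w)"
proof -
  obtain u0 w0 where 0: "norm u0 = 1" "norm w0 = 1" "inner w0 (\<i> *\<^sub>C u0) = 0"
    and min: "\<forall>u w. norm u = 1 \<longrightarrow> norm w = 1 \<longrightarrow> inner w (\<i> *\<^sub>C u) = 0 \<longrightarrow>
       norm (polarized_intensity f u0 w0) \<le> norm (polarized_intensity f u w)"
    using polarized_intensity_attains_min [of f] by (elim exE conjE)
  let ?N = "next_smallest_eigenvalue_R c f"
  define m where "m = norm (polarized_intensity f u0 w0)"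
  have ge: "m\<^sup>2 \<le> ?N (realify c u)" if "norm u = 1" for u
  proof -
    obtain w where w: "norm w = 1" "inner w (\<i> *\<^sub>C u) = 0"
        "?N (realify c u) = (norm (polarized_intensity f u w))\<^sup>2"
      using next_smallest_eigenvalue_R_realify(1) [OF c \<open>norm u = 1\<close>] by blast
    then show ?thesis using min that by (simp add: m_def power_mono)
  qed
  have le: "?N (realify c u0) \<le> m\<^sup>2"
    unfolding m_def using 0 by (intro next_smallest_eigenvalue_R_realify(2) [OF c])
  have u0: "realify c u0 \<in> unit_sphere_R c" using 0 by (simp add: unit_sphere_R_eq [OF c])
  have ge': "?N (realify c u0) \<le> ?N \<xi>" if "\<xi> \<in> unit_sphere_R c" for \<xi>
    using that le ge by (force simp: unit_sphere_R_eq [OF c])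
  then show "\<exists>\<xi>. is_arg_min ?N (\<lambda>\<xi>. \<xi> \<in> unit_sphere_R c) \<xi>"
    using u0 by (intro exI [of _ "realify c u0"]) (simp add: is_arg_min_def not_less)
  have "(INF \<xi>\<in>unit_sphere_R c. ?N \<xi>) = ?N (realify c u0)"
    using u0 ge' by (intro cInf_eq_minimum) auto
  also have "\<dots> = m\<^sup>2" using le ge [OF 0(1)] by (rule antisym)
  finally have A0: "A0 c f = m" by (simp add: A0_def m_def)
  then show "\<exists>u w. norm u = 1 \<and> norm w = 1 \<and> inner w (\<i> *\<^sub>C u) = 0 \<and>
      A0 c f = norm (polarized_intensity f u w)"
    using 0 m_def by blast
  assume orth: "inner w (\<i> *\<^sub>C u) = 0"
  show "A0 c f * (norm u * norm w) \<le> norm (polarized_intensity f u w)"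
  proof (cases "u = 0 \<or> w = 0")
    case False
    have "inner (w /\<^sub>R norm w) (\<i> *\<^sub>C (u /\<^sub>R norm u)) = 0"
      using orth by (simp add: linear_scale [OF linear_scaleC])
    then have "m \<le> norm (polarized_intensity f (u /\<^sub>R norm u) (w /\<^sub>R norm w))"
      unfolding m_def using False by (intro min [rule_format]) auto
    then show ?thesis
      using False polarized_intensity_normalize [of u w f] by (simp add: A0 mult_right_mono)
  qed auto
qed

text \<open>
  If the minimum were \<open>0\<close>, attained at \<open>(u, w)\<close>, then \<open>x = (u + w) / 2\<close> and \<open>y = (u - w) / 2\<close>
  would have equal intensities, hence by injectivity differ by a phase, and so have nuclear
  distance \<open>0\<close>. As \<open>w\<close> is a unit vector orthogonal to \<open>\<i> u\<close>, that distance is \<open>\<parallel>u\<parallel> \<parallel>w\<parallel> = 1\<close>.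
\<close>

lemma A0_pos:
  fixes c :: "'a::complex_euclidean_space \<Rightarrow> 'a"
  assumes c: "conjugation c" and inj: "inj_on (alpha f) H_hat"
  shows "0 < A0 c f"
proof (rule ccontr)
  assume not: "\<not> 0 < A0 c f"
  obtain u w where uw: "norm u = 1" "norm w = 1" "inner w (\<i> *\<^sub>C u) = 0"
      and A: "A0 c f = norm (polarized_intensity f u w)"
    using A0_attained(3) [OF c] by blast
  have b0: "polarized_intensity f u w = 0" using not A by simp
  define x y where "x = (1/2) *\<^sub>R (u + w)" and "y = (1/2) *\<^sub>R (u - w)"
  have xy: "x + y = u" "x - y = w"
    by (simp_all add: x_def y_def scaleR_add_right scaleR_diff_right flip: scaleR_add_left)
  have "alpha f (phase_class x) = alpha f (phase_class y)"
    using intensity_diff [of f x y] b0 by (simp add: alpha_phase_class xy)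
  moreover have "phase_class x \<in> H_hat" "phase_class y \<in> H_hat"
    by (auto simp: H_hat_def intro: quotientI)
  ultimately have "phase_class x = phase_class y" using inj by (simp add: inj_on_eq_iff)
  then have "(x, y) \<in> phase_rel"
    using eq_equiv_class [OF _ equiv_phase_rel] by blast
  then have "nuclear_dist (rank_one x) (rank_one y) = 0"
    by (auto simp: phase_rel_def nuclear_dist_phase)
  moreover obtain w' s where w': "x - y = w' + s *\<^sub>R \<i> *\<^sub>C (x + y)"
      "inner w' (\<i> *\<^sub>C (x + y)) = 0" "nuclear_dist (rank_one x) (rank_one y) = norm (x + y) * norm w'"
    by (rule nuclear_dist_orthogonal_component [of x y])
  ultimately have "w' = 0" using uw by (simp add: xy)
  then have "w = s *\<^sub>R \<i> *\<^sub>C u" using w' by (simp add: xy)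
  then have "inner w w = 0" using uw by simp
  then show False using uw by simp
qed

text \<open>
  Removing from \<open>x - y\<close> its component along \<open>\<i> (x + y)\<close> leaves the difference of the intensities
  unchanged, because \<open>polarized_intensity f u (\<i> u) = 0\<close>, and what remains has precisely the norm
  that occurs in the nuclear distance.
\<close>

lemma lipschitz_bounds:
  assumes c: "conjugation c"
  shows "A0 c f * nuclear_dist (rank_one x) (rank_one y)
      \<le> norm (lifted_map f (rank_one x) - lifted_map f (rank_one y))" (is ?lower)
    and "norm (lifted_map f (rank_one x) - lifted_map f (rank_one y))
      \<le> B0 c f * nuclear_dist (rank_one x) (rank_one y)" (is ?upper)
proof -
  obtain w s where w: "x - y = w + s *\<^sub>R \<i> *\<^sub>C (x + y)" "inner w (\<i> *\<^sub>C (x + y)) = 0"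
    and nd: "nuclear_dist (rank_one x) (rank_one y) = norm (x + y) * norm w"
    by (rule nuclear_dist_orthogonal_component [of x y])
  have "lifted_map f (rank_one x) - lifted_map f (rank_one y) = polarized_intensity f (x + y) (x - y)"
    by (simp add: lifted_map_rank_one alpha_phase_class intensity_diff)
  also have "\<dots> = polarized_intensity f (x + y) w"
    unfolding w(1) using linear_polarized_intensity [of f "x + y"]
    by (simp add: linear_add linear_scale polarized_intensity_i_self)
  finally have eq: "lifted_map f (rank_one x) - lifted_map f (rank_one y)
      = polarized_intensity f (x + y) w" .
  show ?lower unfolding eq nd by (rule A0_attained(2) [OF c w(2)])
  show ?upper unfolding eq nd by (rule B0_attained(2) [OF c])
qed

theorem theorem4p1:
  fixes c :: "'h::complex_euclidean_space \<Rightarrow> 'h"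
    and f :: "'m::finite \<Rightarrow> 'h"
  assumes "conjugation c"
    and "is_frame f"
    and "inj_on (alpha f) H_hat"
  shows "bi_lipschitz_on S10 nuclear_dist (lifted_map f)
    \<and> (\<exists>\<xi>. is_arg_max (norm_R c f) (\<lambda>\<xi>. \<xi> \<in> unit_sphere_R c) \<xi>)
    \<and> (\<exists>\<xi>. is_arg_min (next_smallest_eigenvalue_R c f) (\<lambda>\<xi>. \<xi> \<in> unit_sphere_R c) \<xi>)
    \<and> 0 < A0 c f
    \<and> (\<forall>x y :: 'h.
         A0 c f * nuclear_dist (rank_one x) (rank_one y)
           \<le> norm (lifted_map f (rank_one x) - lifted_map f (rank_one y))
       \<and> norm (lifted_map f (rank_one x) - lifted_map f (rank_one y))
           \<le> B0 c f * nuclear_dist (rank_one x) (rank_one y))"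
proof -
  note c = assms(1)
  have A: "0 < A0 c f" using A0_pos c assms(3) by blast
  have bounds: "A0 c f * nuclear_dist (rank_one x) (rank_one y)
        \<le> norm (lifted_map f (rank_one x) - lifted_map f (rank_one y))"
      "norm (lifted_map f (rank_one x) - lifted_map f (rank_one y))
        \<le> B0 c f * nuclear_dist (rank_one x) (rank_one y)" for x y
    using lipschitz_bounds [OF c] by blast+
  obtain u w where "norm u = 1" "norm w = 1" "A0 c f = norm (polarized_intensity f u w)"
    using A0_attained(3) [OF c] by blast
  then have "A0 c f \<le> B0 c f"
    using B0_attained(2) [OF c, of f u w] by simp
  then have B: "0 < B0 c f"
    using A by simp
  have "bi_lipschitz_on S10 nuclear_dist (lifted_map f)"
    unfolding bi_lipschitz_on_def S10_def
    using A B bounds by (intro exI [of _ "A0 c f"] exI [of _ "B0 c f"] conjI) (auto simp: dist_norm)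
  then show ?thesis
    using A bounds B0_attained(1) [OF c] A0_attained(1) [OF c] by blast
qed

end
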